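(* Let $n\ge2$ and let $L=\partial^n+u_2\partial^{n-2}+\cdots+u_{n-1}\partial+u_n\in\mathcal{R}[\partial]$ be the formal differential operator of order $n$ in normal form. Let $m\ge 2$ be an integer, let $Q$ be the unique monic $n$-th root of $L$ in $\mathcal{R}((\partial^{-1}))$, and let $P_m=(Q^m)_+$ be the operator of order $m$ in the homogeneous basis of $W(L)$. Let $\tilde P_m=\partial^m+y_2\partial^{m-2}+\cdots+y_{m-1}\partial+y_m$ and let $E_{m,k}(U,Y_m)$ be the coefficient of $\partial^k$ in $[L,\tilde P_m]$. Let $Z=\{q_2,\ldots,q_m\}\subset\mathcal{R}$ with weights $w(q_\ell)=\ell$. The following statements are equivalent: 1. $\epsilon_Z(\tilde P_m)=P_m$. 2. $Z$ is a solution, with respect to $Y_m$, of the system $\mathbb{E}_{m,n}=\{E_{m,n+m-j}(U,Y_m)=0\mid j=3,\ldots,m+1\}$, that is, $E_{m,n+m-j}(U,Z)=0$ for $j=3,\ldots,m+1$.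
   Context: $\mathbf{C}$ is a field of characteristic zero with the zero derivation. $U=\{u_2,\ldots,u_n\}$ and $Y_m=\{y_2,\ldots,y_m\}$ are sets of independent differential variables. $\mathcal{R}=\mathbf{C}\{U\}$ is the polynomial ring over $\mathbf{C}$ in the variables $u_\ell^{(k)}$ ($k\ge 0$), with derivation $\partial$ vanishing on $\mathbf{C}$ and $\partial(u_\ell^{(k)})=u_\ell^{(k+1)}$; similarly $\mathcal{R}\{Y_m\}$ is the polynomial ring over $\mathcal{R}$ in the variables $y_\ell^{(k)}$ with $\partial(y_\ell^{(k)})=y_\ell^{(k+1)}$. For a differential ring $S$, $S[\partial]$ is the ring of differential operators with $\partial s=s\partial+\partial(s)$; $[A,B]=AB-BA$. $\mathcal{R}((\partial^{-1}))$ is the ring of pseudo-differential operators $\sum_{-\infty<i\le k}a_i\partial^i$ ($a_i\in\mathcal{R}$, $k\in\mathbb{Z}$), where $\partial^{-1}$ is the inverse of $\partial$ and $\partial^{-1}r=\sum_{i\ge 1}(-1)^{i-1}\partial^{i-1}(r)\partial^{-i}$; the positive part $A_+$ of $A=\sum_{i\le k} a_i\partial^i$ is $\sum_{0\le i\le k}a_i\partial^i$. The monic $n$-th root $Q$ of $L$ is the unique pseudo-differential operator of order one with leading term $\partial$ and $Q^n=L$. $W(L)=\{A\in\mathcal{R}[\partial]\mid \operatorname{ord}([L,A])\le n-2\}$, with $\operatorname{ord}(0)=-\infty$. Weight: $w$ is the grading on $\mathcal{R}$ determined by $w(u_\ell^{(k)})=\ell+k$; the condition $w(q_\ell)=\ell$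 means $q_\ell$ is homogeneous of weight $\ell$ (the zero polynomial being homogeneous of every weight). An operator in $\mathcal{R}[\partial]$ is homogeneous of weight $r$ if its coefficient of $\partial^i$ is homogeneous of weight $r-i$ for every $i$. The homogeneous basis of $W(L)$ is $\mathcal{H}(L)=\{P_j=(Q^j)_+\mid j\in\mathbb{N}\}$, known to be the unique (up to multiplication by constants) $\mathbf{C}$-basis of $W(L)$ whose $j$-th element is homogeneous of weight $j$ for each $j\in\mathbb{N}=\{0,1,2,\dots\}$; each $P_j$ is monic of order $j$. Evaluation: for an indexed family $Z=\{q_2,\ldots,q_m\}\subset\mathcal{R}$, $\epsilon_Z:\mathcal{R}\{Y_m\}\to\mathcal{R}$ is the differential $\mathcal{R}$-algebra homomorphism with $\epsilon_Z(y_\ell^{(k)})=\partial^k(q_\ell)$, extended to differential operators coefficientwise, and $f(U,Z):=\epsilon_Z(f(U,Y_m))$. *)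

theory Defs
  imports
    Complex_Main
    "HOL-Library.Poly_Mapping"
    "HOL-Computational_Algebra.Formal_Power_Series"
begin

section \<open>Differential rings\<close>

class differential_ring = comm_ring_1 +
  fixes der :: "'a \<Rightarrow> 'a"
  assumes der_add: "der (a + b) = der a + der b"
    and der_mult: "der (a * b) = der a * b + a * der b"
begin

lemma der_0 [simp]: "der 0 = 0"
  using der_add[of 0 0] by simp

lemma der_1 [simp]: "der 1 = 0"
  using der_mult[of 1 1] by simp

lemma der_minus: "der (- a) = - der a"
  using der_add[of a "- a"] by (simp add: eq_neg_iff_add_eq_0 add.commute)

lemma der_diff: "der (a - b) = der a - der b"
  using der_add[of a "- b"] by (simp add: der_minus)

lemma der_sum: "der (sum f A) = (\<Sum>x\<in>A. der (f x))"
  by (induction A rule: infinite_finite_induct) (auto simp: der_add)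

lemma der_of_nat [simp]: "der (of_nat k) = 0"
  by (induction k) (auto simp: der_add)

lemma der_of_int [simp]: "der (of_int k) = 0"
  by (cases k rule: int_cases2) (auto simp: der_minus)

lemma funpow_der_0 [simp]: "(der ^^ k) 0 = 0"
  by (induction k) auto

lemma funpow_der_add: "(der ^^ k) (a + b) = (der ^^ k) a + (der ^^ k) b"
  by (induction k) (auto simp: der_add)

lemma funpow_der_minus: "(der ^^ k) (- a) = - (der ^^ k) a"
  by (induction k) (auto simp: der_minus)

lemma funpow_der_sum: "(der ^^ k) (sum f A) = (\<Sum>x\<in>A. (der ^^ k) (f x))"
  by (induction A rule: infinite_finite_induct) (auto simp: funpow_der_add)

lemma funpow_der_1: "(der ^^ k) 1 = (if k = 0 then 1 else 0)"
  by (cases k) (auto simp del: funpow.simps simp: funpow_Suc_right)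

lemma funpow_der_of_int_mult: "(der ^^ k) (of_int c * a) = of_int c * (der ^^ k) a"
  by (induction k) (auto simp: der_mult)

end

lemma funpow_der_mult:
  "(der ^^ k) (a * b :: 'a :: differential_ring) =
     (\<Sum>e\<le>k. of_nat (k choose e) * (der ^^ e) a * (der ^^ (k - e)) b)"
proof (induction k)
  case (Suc k)
  let ?f = "\<lambda>e. (der ^^ e) a" and ?g = "\<lambda>e. (der ^^ e) b"
  have "(der ^^ Suc k) (a * b) = der (\<Sum>e\<le>k. of_nat (k choose e) * ?f e * ?g (k - e))"
    using Suc by simp
  also have "\<dots> = (\<Sum>e\<le>k. of_nat (k choose e) * ?f (Suc e) * ?g (k - e)) +
                  (\<Sum>e\<le>k. of_nat (k choose e) * ?f e * ?g (Suc k - e))"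
    by (simp add: der_sum der_mult sum.distrib[symmetric] Suc_diff_le algebra_simps)
  also have "(\<Sum>e\<le>k. of_nat (k choose e) * ?f (Suc e) * ?g (k - e)) =
             (\<Sum>e\<in>{1..Suc k}. of_nat (k choose (e - 1)) * ?f e * ?g (Suc k - e))"
    by (rule sum.reindex_bij_witness[of _ "\<lambda>e. e - 1" Suc]) auto
  also have "\<dots> = (\<Sum>e\<le>Suc k. of_nat (if e = 0 then 0 else k choose (e - 1)) * ?f e * ?g (Suc k - e))"
    by (rule sum.mono_neutral_cong_left) auto
  also have "(\<Sum>e\<le>k. of_nat (k choose e) * ?f e * ?g (Suc k - e)) =
             (\<Sum>e\<le>Suc k. of_nat (k choose e) * ?f e * ?g (Suc k - e))"
    by (simp add: binomial_eq_0)
  also have "(\<Sum>e\<le>Suc k. of_nat (if e = 0 then 0 else k choose (e - 1)) * ?f e * ?g (Suc k - e)) + \<dots> =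
             (\<Sum>e\<le>Suc k. of_nat (Suc k choose e) * ?f e * ?g (Suc k - e))"
    unfolding sum.distrib[symmetric]
    by (rule sum.cong, simp) (auto simp: algebra_simps gr0_conv_Suc split: if_splits)
  finally show ?case .
qed auto

class constant_field = field_char_0 + differential_ring +
  assumes der_const [simp]: "der c = 0"

instantiation rat :: constant_field
begin
definition der_rat :: "rat \<Rightarrow> rat" where "der_rat c = 0"
instance by standard (auto simp: der_rat_def)
end


section \<open>Differential polynomials\<close>

text \<open>
  The pair \<open>(l, k)\<close> stands for the variable \<open>x\<^sub>l\<^sup>(\<^sup>k\<^sup>)\<close>, and a power product is a finitely supported map from
  variables to exponents. The type contains the differential polynomials in all variables
  \<open>x\<^sub>0, x\<^sub>1, x\<^sub>2, \<dots>\<close>; \<open>dpolys_in\<close> below selects those in a given set of variables.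
\<close>
text \<open>
  The transfer rules of \<open>poly_mapping\<close> would otherwise unfold the power products inside \<open>dpoly\<close> as well.
\<close>
lifting_forget poly_mapping.lifting

type_synonym pprod = "(nat \<times> nat) \<Rightarrow>\<^sub>0 nat"

typedef (overloaded) 'a dpoly = "UNIV :: (pprod \<Rightarrow>\<^sub>0 'a :: zero) set"
  by simp

setup_lifting type_definition_dpoly

instantiation dpoly :: (comm_ring_1) comm_ring_1
begin
lift_definition zero_dpoly :: "'a dpoly" is 0 .
lift_definition one_dpoly :: "'a dpoly" is 1 .
lift_definition plus_dpoly :: "'a dpoly \<Rightarrow> 'a dpoly \<Rightarrow> 'a dpoly" is "(+)" .
lift_definition minus_dpoly :: "'a dpoly \<Rightarrow> 'a dpoly \<Rightarrow> 'a dpoly" is "(-)" .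
lift_definition uminus_dpoly :: "'a dpoly \<Rightarrow> 'a dpoly" is uminus .
lift_definition times_dpoly :: "'a dpoly \<Rightarrow> 'a dpoly \<Rightarrow> 'a dpoly" is "(*)" .
instance by standard (transfer; simp add: algebra_simps)+
end

lift_definition dcoeff :: "'a :: zero dpoly \<Rightarrow> pprod \<Rightarrow> 'a" is Poly_Mapping.lookup .

lift_definition monoms :: "'a :: zero dpoly \<Rightarrow> pprod set" is Poly_Mapping.keys .

lift_definition dmonom :: "pprod \<Rightarrow> 'a \<Rightarrow> 'a :: zero dpoly" is Poly_Mapping.single .

definition dconst :: "'a \<Rightarrow> 'a :: zero dpoly" where
  "dconst c = dmonom 0 c"

definition dvar :: "nat \<Rightarrow> nat \<Rightarrow> 'a :: zero_neq_one dpoly" where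
  "dvar l k = dmonom (Poly_Mapping.single (l, k) 1) 1"

definition dpolys_in :: "nat set \<Rightarrow> 'a :: zero dpoly set" where
  "dpolys_in I = {p. \<forall>\<mu>\<in>monoms p. fst ` Poly_Mapping.keys \<mu> \<subseteq> I}"

lemma finite_monoms [simp]: "finite (monoms p)"
  by transfer simp

lemma dmonom_0 [simp]: "dmonom \<mu> 0 = 0"
  by transfer simp

lemma dmonom_add: "dmonom \<mu> (a + b) = dmonom \<mu> a + dmonom \<mu> b"
  by transfer (simp add: single_add)

lemma dmonom_mult: "dmonom \<mu> a * dmonom \<nu> b = dmonom (\<mu> + \<nu>) (a * b)"
  by transfer (simp add: mult_single)

lemma dmonom_0_1: "dmonom 0 1 = 1"
  by transfer simp

lemma monoms_dmonom: "monoms (dmonom \<mu> c) = (if c = 0 then {} else {\<mu>})"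
  by transfer simp

lemma dcoeff_dmonom [simp]: "dcoeff (dmonom \<mu> c) \<mu> = c"
  by transfer simp

lemma sum_monoms_add:
  fixes p q :: "'a :: comm_ring_1 dpoly" and f :: "pprod \<Rightarrow> 'a \<Rightarrow> 'b :: comm_monoid_add"
  assumes "\<And>\<mu>. f \<mu> 0 = 0" "\<And>\<mu> a b. f \<mu> (a + b) = f \<mu> a + f \<mu> b"
  shows "(\<Sum>\<mu>\<in>monoms (p + q). f \<mu> (dcoeff (p + q) \<mu>)) =
         (\<Sum>\<mu>\<in>monoms p. f \<mu> (dcoeff p \<mu>)) + (\<Sum>\<mu>\<in>monoms q. f \<mu> (dcoeff q \<mu>))"
proof -
  have "monoms p = Poly_Mapping.keys (Rep_dpoly p)" "dcoeff p = Poly_Mapping.lookup (Rep_dpoly p)"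
    for p :: "'a dpoly" by (simp_all add: monoms.rep_eq dcoeff.rep_eq)
  thus ?thesis
    using setsum_keys_plus_distrib[of f "Rep_dpoly p" "Rep_dpoly q"] assms
    by (simp add: plus_dpoly.rep_eq)
qed

lemma dpoly_induct [case_names zero dmonom]:
  fixes p :: "'a :: comm_ring_1 dpoly"
  assumes "P 0" "\<And>\<mu> c p. P p \<Longrightarrow> P (dmonom \<mu> c + p)"
  shows "P p"
proof -
  have *: "p = (\<Sum>\<mu>\<in>monoms p. dmonom \<mu> (dcoeff p \<mu>))"
  proof -
    have Rep_sum: "Rep_dpoly (sum f A) = (\<Sum>x\<in>A. Rep_dpoly (f x))" for f :: "pprod \<Rightarrow> 'a dpoly" and A
      by (induction A rule: infinite_finite_induct) (simp_all add: plus_dpoly.rep_eq zero_dpoly.rep_eq)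
    have "Rep_dpoly p = Rep_dpoly (\<Sum>\<mu>\<in>monoms p. dmonom \<mu> (dcoeff p \<mu>))"
      by (rule poly_mapping_eqI)
         (simp add: Rep_sum dmonom.rep_eq monoms.rep_eq dcoeff.rep_eq lookup_sum lookup_single when_def
            sum.delta in_keys_iff)
    thus ?thesis by (simp add: Rep_dpoly_inject)
  qed
  have "P (\<Sum>\<mu>\<in>A. dmonom \<mu> (dcoeff p \<mu>))" if "finite A" for A
    using that by (induction A) (auto intro: assms)
  from this[of "monoms p"] show ?thesis
    using * by simp
qed

text \<open>
  \<open>der_pprod \<mu>\<close> is the derivative of the power product \<open>\<mu>\<close>: by the Leibniz rule, one factor
  \<open>x\<^sub>l\<^sup>(\<^sup>k\<^sup>)\<close> of \<open>\<mu>\<close> at a time is replaced by \<open>x\<^sub>l\<^sup>(\<^sup>k\<^sup>+\<^sup>1\<^sup>)\<close>.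
\<close>
definition shift_var :: "nat \<times> nat \<Rightarrow> pprod \<Rightarrow> pprod" where
  "shift_var v \<mu> =
     (\<mu> - Poly_Mapping.single v 1) + Poly_Mapping.single (fst v, Suc (snd v)) 1"

definition der_pprod :: "pprod \<Rightarrow> 'a :: comm_ring_1 dpoly" where
  "der_pprod \<mu> = (\<Sum>v\<in>Poly_Mapping.keys \<mu>. dmonom (shift_var v \<mu>) (of_nat (Poly_Mapping.lookup \<mu> v)))"

lemma der_pprod_0 [simp]: "der_pprod 0 = 0"
  by (simp add: der_pprod_def)

lemma der_pprod_add:
  "der_pprod (\<mu> + \<nu>) = der_pprod \<mu> * dmonom \<nu> 1 + dmonom \<mu> 1 * (der_pprod \<nu> :: 'a :: comm_ring_1 dpoly)"
proof -
  define K where "K = Poly_Mapping.keys \<mu> \<union> Poly_Mapping.keys \<nu>"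
  let ?c = "\<lambda>\<mu> v. of_nat (Poly_Mapping.lookup \<mu> v) :: 'a"
  have ext: "der_pprod \<kappa> = (\<Sum>v\<in>K. dmonom (shift_var v \<kappa>) (?c \<kappa> v))" if "Poly_Mapping.keys \<kappa> \<subseteq> K" for \<kappa>
    unfolding der_pprod_def using that
    by (intro sum.mono_neutral_left) (auto simp: K_def in_keys_iff)
  have keys: "Poly_Mapping.keys (\<mu> + \<nu>) \<subseteq> K"
    unfolding K_def by (rule keys_add)
  have shift: "shift_var v (\<kappa> + \<rho>) = shift_var v \<kappa> + \<rho>" if "Poly_Mapping.lookup \<kappa> v \<noteq> 0" for \<kappa> \<rho> v
    using that unfolding shift_var_def
    by (intro poly_mapping_eqI) (auto simp: lookup_add lookup_minus lookup_single when_def)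
  have 1: "dmonom (shift_var v (\<kappa> + \<rho>)) (?c \<kappa> v) = dmonom (shift_var v \<kappa>) (?c \<kappa> v) * dmonom \<rho> 1" for \<kappa> \<rho> v
    by (cases "Poly_Mapping.lookup \<kappa> v = 0") (auto simp: dmonom_mult shift)
  have "dmonom (shift_var v (\<mu> + \<nu>)) (?c (\<mu> + \<nu>) v) =
        dmonom (shift_var v \<mu>) (?c \<mu> v) * dmonom \<nu> 1 + dmonom \<mu> 1 * dmonom (shift_var v \<nu>) (?c \<nu> v)" for v
    using 1[of v \<mu> \<nu>] 1[of v \<nu> \<mu>] by (simp add: lookup_add dmonom_add ac_simps)
  thus ?thesis
    using keys by (simp add: ext K_def sum.distrib sum_distrib_left sum_distrib_right)
qed

instantiation dpoly :: (differential_ring) differential_ring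
begin

definition der_dpoly :: "'a dpoly \<Rightarrow> 'a dpoly" where
  "der_dpoly p = (\<Sum>\<mu>\<in>monoms p. dmonom \<mu> (der (dcoeff p \<mu>)) + dconst (dcoeff p \<mu>) * der_pprod \<mu>)"

instance
proof
  fix p q :: "'a dpoly"
  have add: "der (p + q) = der p + der q" for p q :: "'a dpoly"
    unfolding der_dpoly_def
    by (rule sum_monoms_add) (auto simp: dconst_def der_add dmonom_add algebra_simps)
  have mono: "der (dmonom \<mu> a) = dmonom \<mu> (der a) + dconst a * der_pprod \<mu>" for \<mu> and a :: 'a
    by (auto simp: der_dpoly_def monoms_dmonom dconst_def)
  have m0: "dmonom \<mu> a = dconst a * dmonom \<mu> 1" for \<mu> and a :: 'a
    by (simp add: dconst_def dmonom_mult)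
  have zero: "der (0 :: 'a dpoly) = 0"
    using mono[of 0 0] by (simp add: dconst_def)
  show "der (p + q) = der p + der q"
    by (fact add)
  have mm: "der (dmonom \<mu> a * dmonom \<nu> b) = der (dmonom \<mu> a) * dmonom \<nu> b + dmonom \<mu> a * der (dmonom \<nu> b)"
    for \<mu> \<nu> and a b :: 'a
  proof -
    have c: "dconst (a * b) = dconst a * (dconst b :: 'a dpoly)" 
      by (simp add: dconst_def dmonom_mult)
    have "der (dmonom \<mu> a * dmonom \<nu> b) =
          dmonom (\<mu> + \<nu>) (der a * b) + dmonom (\<mu> + \<nu>) (a * der b) + dconst (a * b) * der_pprod (\<mu> + \<nu>)"
      by (simp add: dmonom_mult mono der_mult dmonom_add)
    also have "\<dots> = der (dmonom \<mu> a) * dmonom \<nu> b + dmonom \<mu> a * der (dmonom \<nu> b)"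
    proof -
      have "dmonom (\<mu> + \<nu>) (der a * b) = dmonom \<mu> (der a) * dmonom \<nu> b"
           "dmonom (\<mu> + \<nu>) (a * der b) = dmonom \<mu> a * dmonom \<nu> (der b)"
        by (simp_all add: dmonom_mult)
      thus ?thesis
        unfolding mono der_pprod_add c
        by (simp add: m0[of \<nu> b] m0[of \<mu> a] algebra_simps)
    qed
    finally show ?thesis .
  qed
  have m: "der (dmonom \<mu> a * q) = der (dmonom \<mu> a) * q + dmonom \<mu> a * der q" for \<mu> and a :: 'a
    by (induction q rule: dpoly_induct) (auto simp: zero add mm algebra_simps)
  show "der (p * q) = der p * q + p * der q"
    by (induction p rule: dpoly_induct) (simp_all add: zero add m distrib_left distrib_right add_ac)
qed

end

lemma der_dconst: "der (dconst c) = dconst (der c)"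
  by (auto simp: der_dpoly_def monoms_dmonom dconst_def)

lemma der_dvar: "der (dvar l k :: 'a :: differential_ring dpoly) = dvar l (Suc k)"
  by (auto simp: der_dpoly_def dvar_def monoms_dmonom dconst_def der_pprod_def shift_var_def dmonom_mult)

text \<open>
  \<open>deval q\<close> is the evaluation homomorphism over the coefficient ring with \<open>x\<^sub>l\<^sup>(\<^sup>k\<^sup>) \<mapsto> \<partial>\<^sup>k(q\<^sub>l)\<close>.
\<close>
definition deval :: "(nat \<Rightarrow> 'a) \<Rightarrow> 'a :: differential_ring dpoly \<Rightarrow> 'a" where
  "deval q p = (\<Sum>\<mu>\<in>monoms p. dcoeff p \<mu> *
     (\<Prod>v\<in>Poly_Mapping.keys \<mu>. (der ^^ snd v) (q (fst v)) ^ Poly_Mapping.lookup \<mu> v))"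

lemma deval_0 [simp]: "deval q 0 = 0"
  using monoms_dmonom[of 0 "0 :: 'a :: differential_ring"] by (simp add: deval_def)

lemma deval_dconst: "deval q (dconst c) = c"
  by (simp add: deval_def dconst_def monoms_dmonom)

lemma deval_dvar: "deval q (dvar l k) = (der ^^ k) (q l)"
  by (simp add: deval_def dvar_def monoms_dmonom)

definition weight :: "pprod \<Rightarrow> nat" where
  "weight \<mu> = (\<Sum>(l, k)\<in>Poly_Mapping.keys \<mu>. Poly_Mapping.lookup \<mu> (l, k) * (l + k))"

definition homogeneous :: "nat \<Rightarrow> 'a :: zero dpoly \<Rightarrow> bool" where
  "homogeneous r p \<longleftrightarrow> (\<forall>\<mu>\<in>monoms p. weight \<mu> = r)"


section \<open>Pseudo-differential operators\<close>

text \<open>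
  An operator is given by its coefficients: \<open>A\<close> stands for \<open>\<Sum>\<^sub>i A\<^sub>i \<partial>\<^sup>i\<close>, with coefficients on the left.
  Differential operators are those whose coefficients at negative indices vanish.
\<close>
typedef (overloaded) 'a pdo = "{A :: int \<Rightarrow> 'a :: zero. \<exists>N. \<forall>i>N. A i = 0}"
  morphisms pcoeff Abs_pdo
  by (rule exI[of _ "\<lambda>_. 0"]) auto

setup_lifting type_definition_pdo

lemma pdo_eqI: "(\<And>i. pcoeff A i = pcoeff B i) \<Longrightarrow> A = B"
  by transfer auto

text \<open>
  The binomial coefficient with an integer upper argument. (\<open>gbinomial\<close> has this instance, but its
  sort constraint keeps it from being entered for type \<open>int\<close>.)
\<close>
definition zbinom :: "int \<Rightarrow> nat \<Rightarrow> int" where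
  "zbinom k p = (\<Prod>i=0..<p. k - of_nat i) div fact p"

lemma of_int_zbinom: "of_int (zbinom k p) = (of_int k gchoose p :: 'a :: field_char_0)"
  unfolding zbinom_def gbinomial_prod_rev[of k p, symmetric] by (rule of_int_gbinomial)

lemma zbinom_0 [simp]: "zbinom k 0 = 1"
  by (simp add: zbinom_def)

lemma zbinom_1 [simp]: "zbinom k (Suc 0) = k"
  by (simp add: zbinom_def)

lemma zbinom_0_left: "zbinom 0 p = (if p = 0 then 1 else 0)"
proof -
  have "of_int (zbinom 0 p) = (of_int (if p = 0 then 1 else 0) :: rat)"
    by (simp add: of_int_zbinom gbinomial_0_left)
  thus ?thesis by linarith
qed

lemma zbinom_of_nat: "zbinom (int n) p = int (n choose p)"
proof -
  have "of_int (zbinom (int n) p) = (of_int (int (n choose p)) :: rat)"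
    by (simp add: of_int_zbinom binomial_gbinomial)
  thus ?thesis by linarith
qed

lemma zbinom_neg1: "zbinom (- 1) p = (- 1) ^ p"
proof -
  have "of_int (zbinom (- 1) p) = (of_int ((- 1) ^ p) :: rat)"
    by (simp add: of_int_zbinom gbinomial_minus[of "1 :: rat", simplified] flip: binomial_gbinomial)
  thus ?thesis by linarith
qed

text \<open>
  Multiplication extends \<open>\<partial>\<^sup>i b = \<Sum>\<^sub>p zbinom i p \<partial>\<^sup>p(b) \<partial>\<^sup>i\<^sup>-\<^sup>p\<close> (\<open>i\<close> an integer, \<open>p \<ge> 0\<close>), the consequence
  of the commutation rules of \<open>\<partial>\<close> and \<open>\<partial>\<^sup>-\<^sup>1\<close>; these rules are \<open>pdo_D_mult_const\<close> and
  \<open>pcoeff_Dinv_mult_const\<close> below.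
\<close>
definition ptimes :: "(int \<Rightarrow> 'a) \<Rightarrow> (int \<Rightarrow> 'a) \<Rightarrow> int \<Rightarrow> 'a :: differential_ring" where
  "ptimes A B s = (\<Sum>(i :: int, j :: int)\<in>{(i, j). A i \<noteq> 0 \<and> B j \<noteq> 0 \<and> s \<le> i + j}.
     A i * of_int (zbinom i (nat (i + j - s))) * (der ^^ nat (i + j - s)) (B j))"

lemma ptimes_eq:
  fixes A B :: "int \<Rightarrow> 'a :: differential_ring"
  assumes A: "\<And>i. i > N \<Longrightarrow> A i = 0" and B: "\<And>i. i > N' \<Longrightarrow> B i = 0"
  assumes I: "finite I" "{s - N'..N} \<subseteq> I" and M: "N + N' - s \<le> int M"
  shows "ptimes A B s = (\<Sum>i\<in>I. \<Sum>p\<le>M. A i * of_int (zbinom i p) * (der ^^ p) (B (s - i + int p)))"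
proof -
  define S where "S = {(i, j). A i \<noteq> 0 \<and> B j \<noteq> 0 \<and> s \<le> i + j}"
  define T where "T = {(i, p). A i \<noteq> 0 \<and> B (s - i + int p) \<noteq> 0}"
  have T: "T \<subseteq> I \<times> {..M}"
  proof safe
    fix i p assume "(i, p) \<in> T"
    hence "i \<le> N" "s - i + int p \<le> N'"
      using A[of i] B[of "s - i + int p"] unfolding T_def by force+
    thus "i \<in> I" "p \<le> M" using I M by auto
  qed
  have "ptimes A B s = (\<Sum>(i, j)\<in>S. A i * of_int (zbinom i (nat (i + j - s))) * (der ^^ nat (i + j - s)) (B j))"
    unfolding ptimes_def S_def by simp
  also have "\<dots> = (\<Sum>(i, p)\<in>T. A i * of_int (zbinom i p) * (der ^^ p) (B (s - i + int p)))"
    by (rule sum.reindex_bij_witness[of _ "\<lambda>(i, p). (i, s - i + int p)" "\<lambda>(i, j). (i, nat (i + j - s))"])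
       (auto simp: S_def T_def)
  also have "\<dots> = (\<Sum>(i, p)\<in>I \<times> {..M}. A i * of_int (zbinom i p) * (der ^^ p) (B (s - i + int p)))"
    using T I(1) by (intro sum.mono_neutral_left) (auto simp: T_def)
  finally show ?thesis
    by (simp add: sum.cartesian_product)
qed

lemma ptimes_bound:
  assumes "\<And>i. i > N \<Longrightarrow> A i = 0" "\<And>i. i > N' \<Longrightarrow> B i = 0" "s > N + N'"
  shows "ptimes A B s = 0"
  using ptimes_eq[OF assms(1,2), where I = "{s-N'..N}" and s = s and M = 0] assms(3) by simp

lemma zbinom_Vandermonde:
  "(\<Sum>k\<le>n. (zbinom a k) * (zbinom b (n - k))) = zbinom (a + b) n"
proof -
  have "of_int (\<Sum>k\<le>n. (zbinom a k) * (zbinom b (n - k))) = (of_int (zbinom (a + b) n) :: rat)"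
    by (simp add: of_int_zbinom gbinomial_Vandermonde[symmetric] atMost_atLeast0)
  thus ?thesis by linarith
qed

lemma zbinom_trinomial:
  "(zbinom a (p + v)) * int ((p + v) choose p) = (zbinom a p) * (zbinom (a - int p) v)"
proof -
  have "of_int ((zbinom a (p + v)) * int ((p + v) choose p)) =
        (of_int ((zbinom a p) * (zbinom (a - int p) v)) :: rat)"
    using gbinomial_trinomial_revision[of p "p + v" "of_int a :: rat"]
    by (simp add: of_int_zbinom binomial_gbinomial)
  thus ?thesis by linarith
qed

lemma assoc_coeffs:
  fixes G :: "nat \<Rightarrow> nat \<Rightarrow> 'a :: comm_ring_1"
  assumes G: "\<And>p q. p + q > M \<Longrightarrow> G p q = 0"
  shows "(\<Sum>p\<le>M. \<Sum>q\<le>M. of_int (zbinom i p) * of_int (zbinom (i + j - int p) q) * G p q) =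
         (\<Sum>r\<le>M. \<Sum>u\<le>M. \<Sum>e\<le>r. of_int (zbinom i r) * of_int (zbinom j u) * of_nat (r choose e) * G e (r - e + u))"
proof -
  have "(\<Sum>p\<le>M. \<Sum>q\<le>M. of_int (zbinom i p) * of_int (zbinom (i + j - int p) q) * G p q) =
        (\<Sum>p\<le>M. \<Sum>q\<le>M. \<Sum>v\<le>q. of_int (zbinom i (p + v)) * of_int (zbinom j (q - v)) * of_nat ((p + v) choose p) * G p q)"
  proof (intro sum.cong refl)
    fix p q
    have "(zbinom i p) * (zbinom (i + j - int p) q) = 
          (\<Sum>v\<le>q. (zbinom i p) * ((zbinom (i - int p) v) * (zbinom j (q - v))))"
      unfolding sum_distrib_left[symmetric] zbinom_Vandermonde by (simp add: algebra_simps)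
    also have "\<dots> = (\<Sum>v\<le>q. (zbinom i (p + v)) * (zbinom j (q - v)) * int ((p + v) choose p))"
      using zbinom_trinomial[of i p] by (intro sum.cong) (auto simp: algebra_simps)
    finally have "of_int (zbinom i p) * of_int (zbinom (i + j - int p) q) = 
      (of_int (\<Sum>v\<le>q. (zbinom i (p + v)) * (zbinom j (q - v)) * int ((p + v) choose p)) :: 'a)"
      by (metis of_int_mult)
    thus "of_int (zbinom i p) * of_int (zbinom (i + j - int p) q) * G p q =
      (\<Sum>v\<le>q. of_int (zbinom i (p + v)) * of_int (zbinom j (q - v)) * of_nat ((p + v) choose p) * G p q)"
      by (simp add: sum_distrib_right)
  qed
  also have "\<dots> = (\<Sum>(p, q, v)\<in>(SIGMA p:{..M}. SIGMA q:{..M}. {..q}).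
      of_int (zbinom i (p + v)) * of_int (zbinom j (q - v)) * of_nat ((p + v) choose p) * G p q)"
    by (simp add: sum.Sigma)
  also have "\<dots> = (\<Sum>(p, q, v)\<in>{(p, q, v). p + q \<le> M \<and> v \<le> q}.
      of_int (zbinom i (p + v)) * of_int (zbinom j (q - v)) * of_nat ((p + v) choose p) * G p q)"
  proof (intro sum.mono_neutral_right ballI)
    fix x assume "x \<in> (SIGMA p:{..M}. SIGMA q:{..M}. {..q}) - {(p, q, v). p + q \<le> M \<and> v \<le> q}"
    then obtain p q v where "x = (p, q, v)" "p + q > M" by (cases x) auto
    thus "(case x of (p, q, v) \<Rightarrow> of_int (zbinom i (p + v)) * of_int (zbinom j (q - v)) *
            of_nat ((p + v) choose p) * G p q) = 0"
      by (simp add: G)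
  qed auto
  also have "\<dots> = (\<Sum>(r, u, e)\<in>{(r, u, e). r + u \<le> M \<and> e \<le> r}.
      of_int (zbinom i r) * of_int (zbinom j u) * of_nat (r choose e) * G e (r - e + u))"
    by (rule sum.reindex_bij_witness[of _ "\<lambda>(r, u, e). (e, r - e + u, r - e)" "\<lambda>(p, q, v). (p + v, q - v, p)"]) auto
  also have "\<dots> = (\<Sum>(r, u, e)\<in>(SIGMA r:{..M}. SIGMA u:{..M}. {..r}).
      of_int (zbinom i r) * of_int (zbinom j u) * of_nat (r choose e) * G e (r - e + u))"
  proof (intro sum.mono_neutral_left ballI)
    fix x assume "x \<in> (SIGMA r:{..M}. SIGMA u:{..M}. {..r}) - {(r, u, e). r + u \<le> M \<and> e \<le> r}"
    then obtain r u e where "x = (r, u, e)" "e + (r - e + u) > M" by (cases x) auto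
    thus "(case x of (r, u, e) \<Rightarrow> of_int (zbinom i r) * of_int (zbinom j u) *
            of_nat (r choose e) * G e (r - e + u)) = 0"
      by (simp add: G)
  qed auto
  also have "\<dots> = (\<Sum>r\<le>M. \<Sum>u\<le>M. \<Sum>e\<le>r.
      of_int (zbinom i r) * of_int (zbinom j u) * of_nat (r choose e) * G e (r - e + u))"
  proof -
    have "(\<Sum>(r, u, e)\<in>(SIGMA r:{..M}. SIGMA u:{..M}. {..r}). F r u e) =
          (\<Sum>r\<le>M. \<Sum>u\<le>M. \<Sum>e\<le>r. F r u e)" for F :: "nat \<Rightarrow> nat \<Rightarrow> nat \<Rightarrow> 'a"
      by (simp add: sum.Sigma)
    thus ?thesis .
  qed
  finally show ?thesis .
qed

lemma ptimes_assoc: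
  fixes A B C :: "int \<Rightarrow> 'a :: differential_ring"
  assumes A: "\<And>i. i > N \<Longrightarrow> A i = 0" and B: "\<And>i. i > N \<Longrightarrow> B i = 0" and C: "\<And>i. i > N \<Longrightarrow> C i = 0"
  shows "ptimes (ptimes A B) C s = ptimes A (ptimes B C) s"
proof -
  define I where "I = {s - 2 * N..N}"
  define M where "M = nat (3 * N - s)"
  define G where "G = (\<lambda>i j p q. (der ^^ p) (B j) * (der ^^ q) (C (s - i - j + int p + int q)))"
  have idx: "s - i - (t - i + int p) + int p + int q = s - t + int q" for i t p q
    by simp
  have AB: "\<And>t. t > 2 * N \<Longrightarrow> ptimes A B t = 0"
    using ptimes_bound[of N A N B] A B by auto
  have BC: "\<And>t. t > 2 * N \<Longrightarrow> ptimes B C t = 0"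
    using ptimes_bound[of N B N C] B C by auto
  have "ptimes (ptimes A B) C s = (\<Sum>t\<in>{s - N..2 * N}. \<Sum>q\<le>M. ptimes A B t * of_int (zbinom t q) * (der ^^ q) (C (s - t + int q)))"
    by (rule ptimes_eq[OF AB C]) (auto simp: M_def)
  also have "\<dots> = (\<Sum>t\<in>{s - N..2 * N}. \<Sum>q\<le>M. (\<Sum>i\<in>I. \<Sum>p\<le>M. A i * of_int (zbinom i p) * (der ^^ p) (B (t - i + int p))) 
                     * of_int (zbinom t q) * (der ^^ q) (C (s - t + int q)))"
  proof (intro sum.cong refl)
    fix t q assume t: "t \<in> {s - N..2 * N}"
    have "ptimes A B t = (\<Sum>i\<in>I. \<Sum>p\<le>M. A i * of_int (zbinom i p) * (der ^^ p) (B (t - i + int p)))"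
      by (rule ptimes_eq[OF A B]) (use t in \<open>auto simp: I_def M_def\<close>)
    thus "ptimes A B t * of_int (zbinom t q) * (der ^^ q) (C (s - t + int q)) =
          (\<Sum>i\<in>I. \<Sum>p\<le>M. A i * of_int (zbinom i p) * (der ^^ p) (B (t - i + int p))) 
                     * of_int (zbinom t q) * (der ^^ q) (C (s - t + int q))" by simp
  qed
  also have "\<dots> = (\<Sum>t\<in>{s - N..2 * N}. \<Sum>q\<le>M. \<Sum>i\<in>I. \<Sum>p\<le>M. A i * of_int (zbinom i p) *
                     of_int (zbinom t q) * G i (t - i + int p) p q)"
    by (simp add: sum_distrib_left sum_distrib_right G_def idx mult_ac)
  also have "\<dots> = (\<Sum>t\<in>{s - N..2 * N}. \<Sum>i\<in>I. \<Sum>q\<le>M. \<Sum>p\<le>M. A i * of_int (zbinom i p) *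
                     of_int (zbinom t q) * G i (t - i + int p) p q)"
    by (intro sum.cong refl sum.swap)
  also have "\<dots> = (\<Sum>i\<in>I. \<Sum>t\<in>{s - N..2 * N}. \<Sum>q\<le>M. \<Sum>p\<le>M. A i * of_int (zbinom i p) *
                     of_int (zbinom t q) * G i (t - i + int p) p q)"
    by (rule sum.swap)
  also have "\<dots> = (\<Sum>i\<in>I. \<Sum>q\<le>M. \<Sum>t\<in>{s - N..2 * N}. \<Sum>p\<le>M. A i * of_int (zbinom i p) *
                     of_int (zbinom t q) * G i (t - i + int p) p q)"
    by (intro sum.cong refl sum.swap)
  also have "\<dots> = (\<Sum>i\<in>I. \<Sum>q\<le>M. \<Sum>p\<le>M. \<Sum>t\<in>{s - N..2 * N}. A i * of_int (zbinom i p) *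
                     of_int (zbinom t q) * G i (t - i + int p) p q)"
    by (intro sum.cong refl sum.swap)
  also have "\<dots> = (\<Sum>i\<in>I. \<Sum>q\<le>M. \<Sum>p\<le>M. \<Sum>j\<in>I. A i * of_int (zbinom i p) *
                     of_int (zbinom (i + j - int p) q) * G i j p q)"
  proof (rule sum.cong[OF refl], rule sum.cong[OF refl], rule sum.cong[OF refl])
    fix i q p assume i: "i \<in> I"
    let ?f = "\<lambda>j. A i * of_int (zbinom i p) * of_int (zbinom (i + j - int p) q) * G i j p q"
    have "(\<Sum>t\<in>{s - N..2 * N}. A i * of_int (zbinom i p) * of_int (zbinom t q) * G i (t - i + int p) p q) =
          (\<Sum>j\<in>{s - N - i + int p..2 * N - i + int p}. ?f j)"
      by (rule sum.reindex_bij_witness[of _ "\<lambda>j. i + j - int p" "\<lambda>t. t - i + int p"]) auto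
    also have "\<dots> = sum ?f {s - N - i + int p + int q..N}"
      using i B C by (intro sum.mono_neutral_right) (auto simp: I_def G_def not_le)
    also have "\<dots> = sum ?f I"
      using i B C by (intro sum.mono_neutral_left) (auto simp: I_def G_def not_le)
    finally show "(\<Sum>t\<in>{s - N..2 * N}. A i * of_int (zbinom i p) * of_int (zbinom t q) * G i (t - i + int p) p q) = sum ?f I" .
  qed
  also have "\<dots> = (\<Sum>i\<in>I. \<Sum>j\<in>I. A i * (\<Sum>p\<le>M. \<Sum>q\<le>M. of_int (zbinom i p) *
                     of_int (zbinom (i + j - int p) q) * G i j p q))"
  proof (rule sum.cong[OF refl], goal_cases)
    case (1 i)
    let ?f = "\<lambda>j p q. A i * of_int (zbinom i p) * of_int (zbinom (i + j - int p) q) * G i j p q"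
    have "(\<Sum>q\<le>M. \<Sum>p\<le>M. \<Sum>j\<in>I. ?f j p q) = (\<Sum>p\<le>M. \<Sum>q\<le>M. \<Sum>j\<in>I. ?f j p q)"
      by (rule sum.swap)
    also have "\<dots> = (\<Sum>p\<le>M. \<Sum>j\<in>I. \<Sum>q\<le>M. ?f j p q)"
      by (intro sum.cong refl sum.swap)
    also have "\<dots> = (\<Sum>j\<in>I. \<Sum>p\<le>M. \<Sum>q\<le>M. ?f j p q)"
      by (rule sum.swap)
    finally show ?case by (simp add: sum_distrib_left mult.assoc)
  qed
  also have "\<dots> = (\<Sum>i\<in>I. \<Sum>j\<in>I. A i * (\<Sum>r\<le>M. \<Sum>u\<le>M. \<Sum>e\<le>r. of_int (zbinom i r) *
                     of_int (zbinom j u) * of_nat (r choose e) * G i j e (r - e + u)))"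
  proof (rule sum.cong[OF refl], rule sum.cong[OF refl], rule arg_cong[of _ _ "(*) _"], rule assoc_coeffs)
    fix i j p q assume "i \<in> I" "j \<in> I" "M < p + q"
    thus "G i j p q = 0" using C by (auto simp: G_def I_def M_def)
  qed
  also have "\<dots> = (\<Sum>i\<in>I. \<Sum>r\<le>M. A i * of_int (zbinom i r) * (der ^^ r) (ptimes B C (s - i + int r)))"
  proof (rule sum.cong[OF refl], goal_cases)
    case (1 i)
    have *: "(der ^^ r) (ptimes B C (s - i + int r)) =
             (\<Sum>j\<in>I. \<Sum>u\<le>M. \<Sum>e\<le>r. of_int (zbinom j u) * of_nat (r choose e) * G i j e (r - e + u))" for r
    proof -
      have "ptimes B C (s - i + int r) = 
            (\<Sum>j\<in>I. \<Sum>u\<le>M. B j * of_int (zbinom j u) * (der ^^ u) (C (s - i + int r - j + int u)))"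
        by (rule ptimes_eq[OF B C]) (use 1 in \<open>auto simp: I_def M_def\<close>)
      also have "\<dots> = (\<Sum>j\<in>I. \<Sum>u\<le>M. of_int (zbinom j u) * (B j * (der ^^ u) (C (s - i + int r - j + int u))))"
        by (simp add: algebra_simps)
      also have "(der ^^ r) \<dots> = (\<Sum>j\<in>I. \<Sum>u\<le>M. \<Sum>e\<le>r. of_int (zbinom j u) * of_nat (r choose e) * G i j e (r - e + u))"
      proof -
        have "of_int (zbinom j u) * (of_nat (r choose e) * (der ^^ e) (B j) *
                (der ^^ (r - e)) ((der ^^ u) (C (s - i + int r - j + int u)))) =
              of_int (zbinom j u) * of_nat (r choose e) * G i j e (r - e + u)" if "e \<le> r" for j u e
        proof -
          have "s - i + int r - j + int u = s - i - j + int e + int (r - e + u)"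
            using that by simp
          thus ?thesis by (simp only: G_def funpow_add o_apply mult.assoc)
        qed
        thus ?thesis
          unfolding funpow_der_sum funpow_der_of_int_mult 
            funpow_der_mult[of r "B _"] sum_distrib_left
          by (intro sum.cong refl, simp only: atMost_iff)
      qed
      finally show ?thesis .
    qed
    have "(\<Sum>j\<in>I. A i * (\<Sum>r\<le>M. \<Sum>u\<le>M. \<Sum>e\<le>r. of_int (zbinom i r) * of_int (zbinom j u) * of_nat (r choose e) * G i j e (r - e + u)))
        = (\<Sum>j\<in>I. \<Sum>r\<le>M. A i * of_int (zbinom i r) * (\<Sum>u\<le>M. \<Sum>e\<le>r. of_int (zbinom j u) * of_nat (r choose e) * G i j e (r - e + u)))"
      by (simp add: sum_distrib_left mult.assoc)
    also have "\<dots> = (\<Sum>r\<le>M. \<Sum>j\<in>I. A i * of_int (zbinom i r) * (\<Sum>u\<le>M. \<Sum>e\<le>r. of_int (zbinom j u) * of_nat (r choose e) * G i j e (r - e + u)))"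
      by (rule sum.swap)
    finally show ?case
      unfolding * by (simp add: sum_distrib_left)
  qed
  also have "\<dots> = ptimes A (ptimes B C) s"
    by (rule ptimes_eq[OF A BC, symmetric]) (auto simp: I_def M_def)
  finally show ?thesis .
qed

lemma ptimes_add_left:
  assumes A: "\<And>i. i > N \<Longrightarrow> A i = 0" and B: "\<And>i. i > N \<Longrightarrow> B i = 0" and C: "\<And>i. i > N \<Longrightarrow> C i = 0"
  shows "ptimes (\<lambda>i. A i + B i) C s = ptimes A C s + ptimes B C s"
proof -
  have AB: "\<And>i. i > N \<Longrightarrow> A i + B i = 0" using A B by simp
  define I M where "I = {s - N..N}" and "M = nat (2 * N - s)"
  show ?thesis
    using ptimes_eq[OF AB C, where I = I and s = s and M = M] ptimes_eq[OF A C, where I = I and s = s and M = M] ptimes_eq[OF B C, where I = I and s = s and M = M]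
    by (simp add: I_def M_def sum.distrib algebra_simps)
qed

lemma ptimes_add_right:
  assumes A: "\<And>i. i > N \<Longrightarrow> A i = 0" and B: "\<And>i. i > N \<Longrightarrow> B i = 0" and C: "\<And>i. i > N \<Longrightarrow> C i = 0"
  shows "ptimes C (\<lambda>i. A i + B i) s = ptimes C A s + ptimes C B s"
proof -
  have AB: "\<And>i. i > N \<Longrightarrow> A i + B i = 0" using A B by simp
  define I M where "I = {s - N..N}" and "M = nat (2 * N - s)"
  show ?thesis
    using ptimes_eq[OF C AB, where I = I and s = s and M = M] ptimes_eq[OF C A, where I = I and s = s and M = M] ptimes_eq[OF C B, where I = I and s = s and M = M]
    by (simp add: I_def M_def sum.distrib algebra_simps funpow_der_add)
qed

lemma ptimes_monom_left:
  assumes B: "\<And>i. i > N \<Longrightarrow> B i = 0"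
  shows "ptimes (\<lambda>i. if i = k then a else 0) B s =
           (\<Sum>p\<le>nat (k + N - s). a * of_int (zbinom k p) * (der ^^ p) (B (s - k + int p)))"
proof -
  have "ptimes (\<lambda>i. if i = k then a else 0) B s =
     (\<Sum>i\<in>insert k {s-N..k}. \<Sum>p\<le>nat (k + N - s). (if i = k then a else 0) * of_int (zbinom i p) * (der ^^ p) (B (s - i + int p)))"
    by (rule ptimes_eq[where N = k and N' = N]) (use B in auto)
  also have "\<dots> = (\<Sum>i\<in>insert k {s-N..k}. if i = k then (\<Sum>p\<le>nat (k + N - s). a * of_int (zbinom i p) * (der ^^ p) (B (s - i + int p))) else 0)"
    by (intro sum.cong) auto
  also have "\<dots> = (\<Sum>p\<le>nat (k + N - s). a * of_int (zbinom k p) * (der ^^ p) (B (s - k + int p)))"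
    by (subst sum.delta) auto
  finally show ?thesis .
qed

lemma ptimes_one_left:
  assumes B: "\<And>i. i > N \<Longrightarrow> B i = 0"
  shows "ptimes (\<lambda>i. if i = 0 then 1 else 0) B s = B s"
proof -
  have "ptimes (\<lambda>i. if i = 0 then 1 else 0) B s =
        (\<Sum>p\<le>nat (N - s). 1 * of_int (zbinom 0 p) * (der ^^ p) (B (s + int p)))"
    using ptimes_monom_left[of N B 0 1 s] B by simp
  also have "\<dots> = (\<Sum>p\<le>nat (N - s). if p = 0 then B s else 0)"
    by (intro sum.cong refl) (auto simp: zbinom_0_left)
  finally show ?thesis by (simp add: sum.delta)
qed

lemma ptimes_one_right:
  assumes B: "\<And>i. i > N \<Longrightarrow> B i = 0"
  shows "ptimes B (\<lambda>i. if i = 0 then 1 else 0) s = B s"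
proof -
  have "ptimes B (\<lambda>i. if i = 0 then 1 else 0) s =
     (\<Sum>i\<in>{s..N}. \<Sum>p\<le>nat (N - s). B i * of_int (zbinom i p) * (der ^^ p) (if s - i + int p = 0 then 1 else 0))"
    by (rule ptimes_eq[where N = N and N' = 0]) (use B in auto)
  also have "\<dots> = (\<Sum>i\<in>{s..N}. \<Sum>p\<le>nat (N - s). if p = 0 then (if i = s then B s else 0) else 0)"
    by (intro sum.cong refl) (auto simp: funpow_der_1)
  also have "\<dots> = B s"
    using B[of s] by (auto simp: sum.delta not_le)
  finally show ?thesis .
qed

instantiation pdo :: (differential_ring) ring_1
begin
lift_definition zero_pdo :: "'a pdo" is "\<lambda>_. 0" by auto
lift_definition one_pdo :: "'a pdo" is "\<lambda>i. if i = 0 then 1 else 0" by (auto intro!: exI[of _ 0])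
lift_definition plus_pdo :: "'a pdo \<Rightarrow> 'a pdo \<Rightarrow> 'a pdo" is "\<lambda>A B i. A i + B i"
proof -
  fix A B :: "int \<Rightarrow> 'a"
  assume "\<exists>N. \<forall>i>N. A i = 0" "\<exists>N. \<forall>i>N. B i = 0"
  then obtain N N' where "\<forall>i>N. A i = 0" "\<forall>i>N'. B i = 0" by blast
  thus "\<exists>N. \<forall>i>N. A i + B i = 0" by (intro exI[of _ "max N N'"]) auto
qed
lift_definition uminus_pdo :: "'a pdo \<Rightarrow> 'a pdo" is "\<lambda>A i. - A i" by auto
lift_definition minus_pdo :: "'a pdo \<Rightarrow> 'a pdo \<Rightarrow> 'a pdo" is "\<lambda>A B i. A i - B i"
proof -
  fix A B :: "int \<Rightarrow> 'a"
  assume "\<exists>N. \<forall>i>N. A i = 0" "\<exists>N. \<forall>i>N. B i = 0"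
  then obtain N N' where "\<forall>i>N. A i = 0" "\<forall>i>N'. B i = 0" by blast
  thus "\<exists>N. \<forall>i>N. A i - B i = 0" by (intro exI[of _ "max N N'"]) auto
qed
lift_definition times_pdo :: "'a pdo \<Rightarrow> 'a pdo \<Rightarrow> 'a pdo" is ptimes
proof -
  fix A B :: "int \<Rightarrow> 'a"
  assume "\<exists>N. \<forall>i>N. A i = 0" "\<exists>N. \<forall>i>N. B i = 0"
  then obtain N N' where "\<forall>i>N. A i = 0" "\<forall>i>N'. B i = 0" by blast
  thus "\<exists>N. \<forall>i>N. ptimes A B i = 0" by (intro exI[of _ "N + N'"]) (auto intro!: ptimes_bound)
qed

instance
proof
  fix A B C :: "'a pdo"
  obtain N1 N2 N3 where N1: "\<forall>i>N1. pcoeff A i = 0" "\<forall>i>N2. pcoeff B i = 0" "\<forall>i>N3. pcoeff C i = 0"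
    using pcoeff[of A] pcoeff[of B] pcoeff[of C] by blast
  define N where "N = max N1 (max N2 N3)"
  have N: "\<And>i. i > N \<Longrightarrow> pcoeff A i = 0" "\<And>i. i > N \<Longrightarrow> pcoeff B i = 0" "\<And>i. i > N \<Longrightarrow> pcoeff C i = 0"
    using N1 by (auto simp: N_def)
  show "A * B * C = A * (B * C)"
    by (rule pdo_eqI) (simp add: times_pdo.rep_eq ptimes_assoc[OF N])
  show "(A + B) * C = A * C + B * C"
    by (rule pdo_eqI) (simp add: times_pdo.rep_eq plus_pdo.rep_eq ptimes_add_left[OF N])
  show "A * (B + C) = A * B + A * C"
    by (rule pdo_eqI) (simp add: times_pdo.rep_eq plus_pdo.rep_eq ptimes_add_right[OF N(2,3,1)])
  show "1 * A = A" "A * 1 = A"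
    by (rule pdo_eqI, simp add: times_pdo.rep_eq one_pdo.rep_eq ptimes_one_left[OF N(1)] ptimes_one_right[OF N(1)])+
  show "(0 :: 'a pdo) \<noteq> 1"
    by (metis one_pdo.rep_eq zero_neq_one zero_pdo.rep_eq)
qed (transfer; simp add: algebra_simps)+
end

lift_definition pdo_monom :: "'a \<Rightarrow> int \<Rightarrow> 'a :: zero pdo" is "\<lambda>a k i. if i = k then a else 0"
  by (metis less_irrefl)

abbreviation pdo_const :: "'a \<Rightarrow> 'a :: zero pdo" where
  "pdo_const a \<equiv> pdo_monom a 0"

abbreviation pdo_D :: "'a :: zero_neq_one pdo" where
  "pdo_D \<equiv> pdo_monom 1 1"

lemma pdo_D_mult_const: "pdo_D * pdo_const a = pdo_const a * pdo_D + pdo_const (der a)"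
proof (rule pdo_eqI)
  fix s
  have "pcoeff (pdo_D * pdo_const a) s =
        (\<Sum>p\<le>nat (1 - s). of_int (zbinom 1 p) * (der ^^ p) (if s - 1 + int p = 0 then a else 0))"
    unfolding times_pdo.rep_eq pdo_monom.rep_eq by (subst ptimes_monom_left[where N = 0]) auto
  also have "\<dots> = (\<Sum>p\<in>{0,1}. of_int (zbinom 1 p) * (der ^^ p) (if s - 1 + int p = 0 then a else 0))"
  proof (cases "s \<le> 0")
    case True
    have "zbinom 1 p = 0" if "p \<notin> {0,1}" for p
      using zbinom_of_nat[of 1 p] that by auto
    thus ?thesis using True by (intro sum.mono_neutral_right) auto
  qed auto
  also have "\<dots> = pcoeff (pdo_const a * pdo_D + pdo_const (der a)) s"
  proof -
    have "pcoeff (pdo_const a * pdo_D) s = 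
            (\<Sum>p\<le>nat (1 - s). a * of_int (zbinom 0 p) * (der ^^ p) (if s + int p = 1 then 1 else 0))"
      unfolding times_pdo.rep_eq pdo_monom.rep_eq by (subst ptimes_monom_left[where N = 1]) auto
    also have "\<dots> = (\<Sum>p\<le>nat (1 - s). if p = 0 then if s = 1 then a else 0 else 0)"
      by (intro sum.cong refl) (auto simp: zbinom_0_left)
    finally show ?thesis by (simp add: plus_pdo.rep_eq pdo_monom.rep_eq sum.delta)
  qed
  finally show "pcoeff (pdo_D * pdo_const a) s = pcoeff (pdo_const a * pdo_D + pdo_const (der a)) s" .
qed

lemma pdo_D_mult_Dinv:
  "pdo_D * pdo_monom 1 (-1) = (1 :: 'a :: differential_ring pdo)"
  "pdo_monom 1 (-1) * pdo_D = (1 :: 'a :: differential_ring pdo)"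
proof -
  have *: "pdo_monom 1 k * pdo_monom 1 l = (pdo_monom 1 (k + l) :: 'a pdo)" for k l
  proof (rule pdo_eqI)
    fix s
    have "pcoeff (pdo_monom 1 k * pdo_monom 1 l :: 'a pdo) s =
        (\<Sum>p\<le>nat (k + l - s). of_int (zbinom k p) * (der ^^ p) (if s - k + int p = l then 1 else 0))"
      unfolding times_pdo.rep_eq pdo_monom.rep_eq by (subst ptimes_monom_left[where N = l]) auto
    also have "\<dots> = (\<Sum>p\<le>nat (k + l - s). if p = 0 then if s = k + l then 1 else 0 else 0)"
      by (intro sum.cong refl) (auto simp: funpow_der_1)
    finally show "pcoeff (pdo_monom 1 k * pdo_monom 1 l :: 'a pdo) s = pcoeff (pdo_monom 1 (k + l)) s"
      by (simp add: pdo_monom.rep_eq sum.delta)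
  qed
  have 1: "pdo_monom 1 0 = (1 :: 'a pdo)" by (rule pdo_eqI) (simp add: one_pdo.rep_eq pdo_monom.rep_eq)
  show "pdo_D * pdo_monom 1 (-1) = (1 :: 'a pdo)" "pdo_monom 1 (-1) * pdo_D = (1 :: 'a pdo)"
    by (simp_all add: * 1)
qed

lemma pcoeff_Dinv_mult_const:
  "pcoeff (pdo_monom 1 (-1) * pdo_const a) s =
     (if s \<le> -1 then (-1) ^ nat (- 1 - s) * (der ^^ nat (- 1 - s)) a else 0)"
proof -
  have "pcoeff (pdo_monom 1 (-1) * pdo_const a) s =
      (\<Sum>p\<le>nat (- 1 - s). of_int (zbinom (- 1) p) * (der ^^ p) (if s + 1 + int p = 0 then a else 0))"
    unfolding times_pdo.rep_eq pdo_monom.rep_eq by (subst ptimes_monom_left[where N = 0]) auto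
  also have "\<dots> = (\<Sum>p\<le>nat (- 1 - s). if p = nat (- 1 - s) then if s \<le> -1 then (-1) ^ p * (der ^^ p) a else 0 else 0)"
    by (intro sum.cong refl) (auto simp: zbinom_neg1)
  finally show ?thesis by (simp add: sum.delta)
qed

lift_definition positive_part :: "'a :: zero pdo \<Rightarrow> 'a pdo" is "\<lambda>A i. if i \<ge> 0 then A i else 0"
  by auto

definition commutator :: "'a :: ring \<Rightarrow> 'a \<Rightarrow> 'a" where
  "commutator A B = A * B - B * A"

text \<open>
  Coefficientwise application of \<open>f\<close>, for \<open>f\<close> with \<open>f 0 = 0\<close>; the case distinction only serves to make
  the definition total.
\<close>
lift_definition map_pdo :: "('a \<Rightarrow> 'b) \<Rightarrow> 'a :: zero pdo \<Rightarrow> 'b :: zero pdo" is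
  "\<lambda>f A i. if A i = 0 then 0 else f (A i)"
  by auto

definition normal_op :: "nat \<Rightarrow> (nat \<Rightarrow> 'a) \<Rightarrow> 'a :: differential_ring pdo" where
  "normal_op n a = pdo_D ^ n + (\<Sum>l=2..n. pdo_const (a l) * pdo_D ^ (n - l))"

text \<open>
  The root is sought among the operators with coefficients in \<open>R\<close>, since \<open>C{U}\<close> is a proper subring of
  the type of all differential polynomials.
\<close>
definition monic_root :: "'a set \<Rightarrow> nat \<Rightarrow> 'a pdo \<Rightarrow> 'a :: differential_ring pdo" where
  "monic_root R n L = (THE Q. range (pcoeff Q) \<subseteq> R \<and>
     pcoeff Q 1 = 1 \<and> (\<forall>i>1. pcoeff Q i = 0) \<and> Q ^ n = L)"


section \<open>The formal operator and the homogeneous basis\<close>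

text \<open>The ring \<open>C{U}\<close> with \<open>U = {u\<^sub>2, \<dots>, u\<^sub>n}\<close>.\<close>
abbreviation dpolys_U :: "nat \<Rightarrow> 'c :: constant_field dpoly set" where
  "dpolys_U n \<equiv> dpolys_in {2..n}"

definition formal_L :: "nat \<Rightarrow> 'c :: constant_field dpoly pdo" where
  "formal_L n = normal_op n (\<lambda>l. dvar l 0)"

definition P_op :: "nat \<Rightarrow> nat \<Rightarrow> 'c :: constant_field dpoly pdo" where
  "P_op n j = positive_part (monic_root (dpolys_U n) n (formal_L n) ^ j)"

text \<open>
  Over \<open>C{U}{Y}\<close>, represented by iterating \<open>dpoly\<close>: the outer variables are the \<open>y\<^sub>l\<close>, and \<open>dconst\<close> embeds
  \<open>C{U}\<close>.
\<close>
definition formal_P :: "nat \<Rightarrow> 'c :: constant_field dpoly dpoly pdo" where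
  "formal_P m = normal_op m (\<lambda>l. dvar l 0)"

definition E_coeff :: "nat \<Rightarrow> nat \<Rightarrow> int \<Rightarrow> 'c :: constant_field dpoly dpoly" where
  "E_coeff n m k = pcoeff (commutator (map_pdo dconst (formal_L n)) (formal_P m)) k"

end

theory Submission
  imports Defs
begin

text \<open>
  Since \<open>L = Q\<^sup>n\<close> commutes with \<open>Q\<^sup>m\<close>, the commutator of \<open>L\<close> with \<open>P\<^sub>m = (Q\<^sup>m)\<^sub>+\<close> is minus that of \<open>L\<close> with the
  part of \<open>Q\<^sup>m\<close> of negative order, and hence has order at most \<open>n - 2\<close>. Conversely, let \<open>A\<close> be the
  evaluated operator and suppose that \<open>[L, A]\<close> has order at most \<open>n - 2\<close>. If \<open>D = A - P\<^sub>m\<close> had order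
  \<open>t \<ge> 0\<close> with leading coefficient \<open>d\<close>, then the coefficient of \<open>\<partial>\<^sup>n\<^sup>+\<^sup>t\<^sup>-\<^sup>1\<close> in \<open>[L, D]\<close>, which is \<open>n \<partial>(d)\<close>, would
  vanish, so \<open>d\<close> would be a constant; but \<open>d\<close> is homogeneous of weight \<open>m - t > 0\<close>. The homogeneity of \<open>P\<^sub>m\<close>
  comes from the construction of \<open>Q\<close>, whose coefficients are determined one at a time by
  those of \<open>L\<close>.
\<close>

section \<open>Differential polynomials\<close>

text \<open>Adding a single variable, rather than a whole power of one, lets the Leibniz rule
  \<open>der_pprod_add\<close> reduce \<open>deval_der_pprod\<close> to
  \<open>der_pprod_single\<close>.\<close>

lemma pprod_induct [case_names zero add_var]:
  fixes \<mu> :: pprod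
  assumes "P 0" and "\<And>v \<mu>. P \<mu> \<Longrightarrow> P (Poly_Mapping.single v 1 + \<mu>)"
  shows "P \<mu>"
proof (induction \<mu> rule: update_induct)
  case const
  show ?case by (rule assms(1))
next
  case (update f a b)
  have "P (Poly_Mapping.single a k + f)" for k
  proof (induction k)
    case 0
    show ?case using update by simp
  next
    case (Suc k)
    have "Poly_Mapping.single a (Suc k) = Poly_Mapping.single a 1 + Poly_Mapping.single a k"
      by (simp add: single_add[symmetric])
    thus ?case using assms(2)[OF Suc, of a] by (simp add: add.assoc)
  qed
  moreover have "Poly_Mapping.update a b f = Poly_Mapping.single a b + f"
    using update(1) by (intro poly_mapping_eqI)
      (auto simp: lookup_update lookup_add lookup_single when_def in_keys_iff)
  ultimately show ?case by simp
qed

lemma der_dmonom: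
  "der (dmonom \<mu> a) = dmonom \<mu> (der a) + dconst a * (der_pprod \<mu> :: 'a :: differential_ring dpoly)"
  by (auto simp: der_dpoly_def monoms_dmonom dconst_def)

lemma der_pprod_single:
  "der_pprod (Poly_Mapping.single (l, k) 1) = (dvar l (Suc k) :: 'a :: differential_ring dpoly)"
  by (auto simp: der_pprod_def shift_var_def dvar_def)

subsection \<open>Evaluation is a differential homomorphism\<close>

text \<open>Two instances matter: the evaluation \<open>deval q\<close> and the embedding
  \<open>dconst\<close> of the coefficients, which \<open>deval q\<close> undoes.\<close>

locale diff_ring_hom =
  fixes f :: "'a :: differential_ring \<Rightarrow> 'b :: differential_ring"
  assumes hom_add: "f (a + b) = f a + f b"
    and hom_mult: "f (a * b) = f a * f b"
    and hom_1: "f 1 = 1"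
    and hom_der: "f (der a) = der (f a)"
begin

lemma hom_0: "f 0 = 0"
  using hom_add[of 0 0] by simp

lemma hom_minus: "f (- a) = - f a"
  using hom_add[of a "- a"] by (simp add: hom_0 eq_neg_iff_add_eq_0 add.commute)

lemma hom_diff: "f (a - b) = f a - f b"
  using hom_add[of a "- b"] by (simp add: hom_minus)

lemma hom_sum: "f (sum g A) = (\<Sum>x\<in>A. f (g x))"
  by (induction A rule: infinite_finite_induct) (auto simp: hom_0 hom_add)

lemma hom_of_nat: "f (of_nat k) = of_nat k"
  by (induction k) (auto simp: hom_0 hom_1 hom_add)

lemma hom_of_int: "f (of_int k) = of_int k"
  by (cases k rule: int_cases2) (auto simp: hom_minus hom_of_nat)

lemma hom_funpow_der: "f ((der ^^ k) a) = (der ^^ k) (f a)"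
  by (induction k) (auto simp: hom_der)

lemma pcoeff_map_pdo: "pcoeff (map_pdo f A) i = f (pcoeff A i)"
  by (simp add: map_pdo.rep_eq hom_0)

lemma map_pdo_diff: "map_pdo f (A - B) = map_pdo f A - map_pdo f B"
  by (rule pdo_eqI) (simp add: pcoeff_map_pdo minus_pdo.rep_eq hom_diff)

lemma map_pdo_mult: "map_pdo f (A * B) = map_pdo f A * map_pdo f B"
proof (rule pdo_eqI)
  fix s
  obtain N where A: "\<And>i. i > N \<Longrightarrow> pcoeff A i = 0" using pcoeff[of A] by blast
  obtain N' where B: "\<And>i. i > N' \<Longrightarrow> pcoeff B i = 0" using pcoeff[of B] by blast
  have A': "\<And>i. i > N \<Longrightarrow> pcoeff (map_pdo f A) i = 0"
    and B': "\<And>i. i > N' \<Longrightarrow> pcoeff (map_pdo f B) i = 0"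
    using A B by (auto simp: pcoeff_map_pdo hom_0)
  \<comment> \<open>Coefficients may vanish under \<open>f\<close>, so both products are expanded
    over one index range given by order bounds instead of supports.\<close>
  define I M where "I = {s - N'..N}" and "M = nat (N + N' - s)"
  have I: "finite I" "{s - N'..N} \<subseteq> I" "N + N' - s \<le> int M" by (auto simp: I_def M_def)
  show "pcoeff (map_pdo f (A * B)) s = pcoeff (map_pdo f A * map_pdo f B) s"
    by (simp add: pcoeff_map_pdo times_pdo.rep_eq ptimes_eq[OF A B I] ptimes_eq[OF A' B' I]
        hom_sum hom_mult hom_of_int hom_funpow_der)
qed

lemma map_pdo_commutator: "map_pdo f (commutator A B) = commutator (map_pdo f A) (map_pdo f B)"
  by (simp add: commutator_def map_pdo_diff map_pdo_mult)

end

text \<open>The factor that a power product contributes in \<open>deval\<close>, isolated so that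
  its multiplicativity can be stated.\<close>

definition eval_pprod :: "(nat \<Rightarrow> 'a :: differential_ring) \<Rightarrow> pprod \<Rightarrow> 'a" where
  "eval_pprod q \<mu> = (\<Prod>v\<in>Poly_Mapping.keys \<mu>. (der ^^ snd v) (q (fst v)) ^ Poly_Mapping.lookup \<mu> v)"

lemma eval_pprod_add: "eval_pprod q (\<mu> + \<nu>) = eval_pprod q \<mu> * eval_pprod q \<nu>"
proof -
  define K where "K = Poly_Mapping.keys \<mu> \<union> Poly_Mapping.keys \<nu>"
  have ext: "eval_pprod q \<kappa> = (\<Prod>v\<in>K. (der ^^ snd v) (q (fst v)) ^ Poly_Mapping.lookup \<kappa> v)"
    if "Poly_Mapping.keys \<kappa> \<subseteq> K" for \<kappa>
    unfolding eval_pprod_def using that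
    by (intro prod.mono_neutral_left) (auto simp: K_def in_keys_iff)
  have "Poly_Mapping.keys (\<mu> + \<nu>) \<subseteq> K"
    unfolding K_def by (rule keys_add)
  thus ?thesis
    by (simp add: ext K_def lookup_add power_add prod.distrib)
qed

lemma deval_dmonom: "deval q (dmonom \<mu> a) = a * eval_pprod q \<mu>"
  by (simp add: deval_def eval_pprod_def monoms_dmonom)

lemma deval_add: "deval q (p + p') = deval q p + deval q p'"
  unfolding deval_def by (rule sum_monoms_add) (auto simp: algebra_simps)

lemma deval_mult: "deval q (p * p') = deval q p * deval q p'"
proof -
  have "deval q (dmonom \<mu> a * p') = deval q (dmonom \<mu> a) * deval q p'" for \<mu> a
    by (induction p' rule: dpoly_induct)
      (auto simp: distrib_left deval_add deval_dmonom dmonom_mult eval_pprod_add mult_ac)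
  thus ?thesis
    by (induction p rule: dpoly_induct) (auto simp: deval_add distrib_right)
qed

lemma eval_pprod_0 [simp]: "eval_pprod q 0 = 1"
  by (simp add: eval_pprod_def)

lemma eval_pprod_single: "eval_pprod q (Poly_Mapping.single (l, k) 1) = (der ^^ k) (q l)"
  by (simp add: eval_pprod_def)

lemma deval_der_pprod: "deval q (der_pprod \<mu>) = der (eval_pprod q \<mu>)"
proof (induction \<mu> rule: pprod_induct)
  case (add_var v \<mu>)
  thus ?case
    by (cases v) (simp only: der_pprod_add deval_add deval_mult deval_dmonom eval_pprod_add der_mult
        der_pprod_single deval_dvar eval_pprod_single funpow.simps o_apply mult_1_left)
qed simp

lemma deval_der: "deval q (der p) = der (deval q p)"
  by (induction p rule: dpoly_induct)
    (simp_all add: der_add deval_add der_dmonom deval_dmonom deval_mult deval_dconst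
       deval_der_pprod der_mult)

lemma diff_ring_hom_deval: "diff_ring_hom (deval q)"
  by unfold_locales
    (simp_all add: deval_add deval_mult deval_der deval_dmonom flip: dmonom_0_1)

subsection \<open>Homogeneous elements\<close>

lemma monoms_0 [simp]: "monoms (0 :: 'a :: comm_ring_1 dpoly) = {}"
  using monoms_dmonom[of 0 "0 :: 'a"] by simp

lemma monoms_add: "monoms (p + q) \<subseteq> monoms p \<union> monoms (q :: 'a :: comm_ring_1 dpoly)"
  by transfer (rule keys_add)

lemma monoms_uminus: "monoms (- p) = monoms (p :: 'a :: comm_ring_1 dpoly)"
  by transfer simp

lemma monoms_mult:
  "monoms (p * q) \<subseteq> {\<mu> + \<nu> | \<mu> \<nu>. \<mu> \<in> monoms p \<and> \<nu> \<in> monoms (q :: 'a :: comm_ring_1 dpoly)}"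
  by transfer (rule keys_mult)

lemma monoms_eq_empty_iff: "monoms p = {} \<longleftrightarrow> (p :: 'a :: comm_ring_1 dpoly) = 0"
  by transfer (metis keys_eq_empty)

lemma dcoeff_0: "dcoeff (0 :: 'a :: comm_ring_1 dpoly) \<mu> = 0"
  by transfer simp

lemma dcoeff_add: "dcoeff (p + q) \<mu> = dcoeff p \<mu> + dcoeff (q :: 'a :: comm_ring_1 dpoly) \<mu>"
  by transfer (simp add: lookup_add)

lemma dcoeff_sum: "dcoeff (\<Sum>x\<in>A. f x) \<mu> = (\<Sum>x\<in>A. dcoeff (f x :: 'a :: comm_ring_1 dpoly) \<mu>)"
  by (induction A rule: infinite_finite_induct) (auto simp: dcoeff_0 dcoeff_add)

lemma dcoeff_dmonom': "dcoeff (dmonom \<mu> c) \<nu> = (if \<mu> = \<nu> then c else 0)"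
  by transfer (simp add: lookup_single when_def)

lemma in_monoms_iff: "\<mu> \<in> monoms p \<longleftrightarrow> dcoeff p \<mu> \<noteq> 0"
  by transfer (rule in_keys_iff)

section \<open>The weight grading\<close>

lemma weight_add: "weight (\<mu> + \<nu>) = weight \<mu> + weight \<nu>"
proof -
  define K where "K = Poly_Mapping.keys \<mu> \<union> Poly_Mapping.keys \<nu>"
  have ext: "weight \<kappa> = (\<Sum>(l, k)\<in>K. Poly_Mapping.lookup \<kappa> (l, k) * (l + k))"
    if "Poly_Mapping.keys \<kappa> \<subseteq> K" for \<kappa>
    unfolding weight_def using that
    by (intro sum.mono_neutral_left) (auto simp: K_def in_keys_iff)
  have "Poly_Mapping.keys (\<mu> + \<nu>) \<subseteq> K"
    unfolding K_def by (rule keys_add)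
  thus ?thesis
    by (simp add: ext K_def lookup_add sum.distrib algebra_simps case_prod_unfold)
qed

lemma weight_single: "weight (Poly_Mapping.single (l, k) e) = e * (l + k)"
  by (simp add: weight_def)

text \<open>Membership in the subring on the indices \<open>I\<close> and homogeneity travel
  together through all closure rules. The weight is an integer because the coefficient of
  \<partial>^i in an operator of weight r has weight r - i; for negative \<open>w\<close> only 0
  remains.\<close>

definition graded :: "nat set \<Rightarrow> int \<Rightarrow> 'a :: zero dpoly set" where
  "graded I w = {p \<in> dpolys_in I. \<forall>\<mu>\<in>monoms p. int (weight \<mu>) = w}"

lemma graded_iff:
  "p \<in> graded I w \<longleftrightarrow>
     (\<forall>\<mu>\<in>monoms p. fst ` Poly_Mapping.keys \<mu> \<subseteq> I \<and> int (weight \<mu>) = w)"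
  by (auto simp: graded_def dpolys_in_def)

lemma graded_0 [simp]: "(0 :: 'a :: comm_ring_1 dpoly) \<in> graded I w"
  by (simp add: graded_iff)

lemma graded_add:
  "p \<in> graded I w \<Longrightarrow> q \<in> graded I w \<Longrightarrow> p + (q :: 'a :: comm_ring_1 dpoly) \<in> graded I w"
  unfolding graded_iff using monoms_add[of p q] by blast

lemma graded_uminus: "p \<in> graded I w \<Longrightarrow> - (p :: 'a :: comm_ring_1 dpoly) \<in> graded I w"
  by (simp add: graded_iff monoms_uminus)

lemma graded_diff:
  "p \<in> graded I w \<Longrightarrow> q \<in> graded I w \<Longrightarrow> p - (q :: 'a :: comm_ring_1 dpoly) \<in> graded I w"
  using graded_add[of p I w "- q"] graded_uminus[of q] by simp

lemma graded_sum:
  "(\<And>x. x \<in> A \<Longrightarrow> f x \<in> graded I w) \<Longrightarrow> sum f A \<in> (graded I w :: 'a :: comm_ring_1 dpoly set)"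
  by (induction A rule: infinite_finite_induct) (auto intro: graded_add)

lemma graded_mult:
  assumes "p \<in> graded I v" "q \<in> graded I w"
  shows "p * (q :: 'a :: comm_ring_1 dpoly) \<in> graded I (v + w)"
  unfolding graded_iff
proof
  fix \<kappa> assume "\<kappa> \<in> monoms (p * q)"
  then obtain \<mu> \<nu> where *: "\<kappa> = \<mu> + \<nu>" "\<mu> \<in> monoms p" "\<nu> \<in> monoms q"
    using monoms_mult[of p q] by blast
  have "fst ` Poly_Mapping.keys \<mu> \<subseteq> I" "fst ` Poly_Mapping.keys \<nu> \<subseteq> I"
    and w: "int (weight \<mu>) = v" "int (weight \<nu>) = w"
    using * assms by (simp_all add: graded_iff)
  hence "fst ` (Poly_Mapping.keys \<mu> \<union> Poly_Mapping.keys \<nu>) \<subseteq> I"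
    by (simp add: image_Un)
  hence "fst ` Poly_Mapping.keys \<kappa> \<subseteq> I"
    unfolding * by (rule order.trans[OF image_mono[OF keys_add]])
  moreover have "int (weight \<kappa>) = v + w"
    by (simp add: * weight_add w)
  ultimately show "fst ` Poly_Mapping.keys \<kappa> \<subseteq> I \<and> int (weight \<kappa>) = v + w" ..
qed

lemma graded_dmonom:
  "fst ` Poly_Mapping.keys \<mu> \<subseteq> I \<Longrightarrow> dmonom \<mu> c \<in> graded I (int (weight \<mu>))"
  by (auto simp: graded_iff monoms_dmonom)

lemma graded_dconst: "dconst c \<in> graded I 0"
  using graded_dmonom[of 0 I c] by (simp add: dconst_def weight_def)

lemma graded_1: "(1 :: 'a :: comm_ring_1 dpoly) \<in> graded I 0"
  using graded_dconst[of "1 :: 'a" I] by (simp add: dconst_def dmonom_0_1)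

lemma graded_of_nat: "(of_nat k :: 'a :: comm_ring_1 dpoly) \<in> graded I 0"
  by (induction k) (auto intro: graded_add graded_1)

lemma graded_of_int: "(of_int k :: 'a :: comm_ring_1 dpoly) \<in> graded I 0"
  by (cases k rule: int_cases2) (auto intro: graded_of_nat graded_uminus)

lemma graded_dvar: "l \<in> I \<Longrightarrow> (dvar l k :: 'a :: zero_neq_one dpoly) \<in> graded I (int (l + k))"
  using graded_dmonom[of "Poly_Mapping.single (l, k) 1" I "1 :: 'a"]
  by (simp add: dvar_def weight_single)

section \<open>The derivation and the weight\<close>

lemma remove_var_add:
  fixes \<mu> :: pprod
  assumes "v \<in> Poly_Mapping.keys \<mu>"
  shows "\<mu> = (\<mu> - Poly_Mapping.single v 1) + Poly_Mapping.single v 1"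
proof (rule poly_mapping_eqI)
  fix x
  have "Poly_Mapping.lookup \<mu> v > 0" using assms by (simp add: in_keys_iff)
  thus "Poly_Mapping.lookup \<mu> x =
      Poly_Mapping.lookup (\<mu> - Poly_Mapping.single v 1 + Poly_Mapping.single v 1) x"
    by (cases "v = x") (simp_all add: lookup_add lookup_minus lookup_single)
qed

lemma weight_remove_var:
  assumes "(l, k) \<in> Poly_Mapping.keys \<mu>"
  shows "weight \<mu> = weight (\<mu> - Poly_Mapping.single (l, k) 1) + (l + k)"
proof -
  have "weight \<mu> = weight (\<mu> - Poly_Mapping.single (l, k) 1 + Poly_Mapping.single (l, k) 1)"
    by (rule arg_cong[OF remove_var_add[OF assms]])
  thus ?thesis by (simp only: weight_add weight_single mult_1_left)
qed

lemma keys_shift_var: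
  "Poly_Mapping.keys (shift_var v \<mu>) \<subseteq> insert (fst v, Suc (snd v)) (Poly_Mapping.keys \<mu>)"
  by (auto simp: shift_var_def in_keys_iff lookup_add lookup_minus lookup_single when_def
      split: if_splits)

lemma weight_shift_var:
  assumes "v \<in> Poly_Mapping.keys \<mu>"
  shows "weight (shift_var v \<mu>) = Suc (weight \<mu>)"
proof -
  obtain l k where v: "v = (l, k)" by fastforce
  from weight_remove_var[OF assms[unfolded v]] show ?thesis
    unfolding v shift_var_def weight_add weight_single by simp
qed

text \<open>Each term raises one factor to its next derivative, which keeps the index of the
  variable and adds 1 to the weight.\<close>

lemma graded_der_pprod:
  assumes "fst ` Poly_Mapping.keys \<mu> \<subseteq> I"
  shows "(der_pprod \<mu> :: 'a :: comm_ring_1 dpoly) \<in> graded I (int (weight \<mu>) + 1)"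
  unfolding der_pprod_def
proof (rule graded_sum)
  fix v assume v: "v \<in> Poly_Mapping.keys \<mu>"
  have "fst ` Poly_Mapping.keys (shift_var v \<mu>) \<subseteq> I"
    by (rule order.trans[OF image_mono[OF keys_shift_var]]) (use v assms in auto)
  from graded_dmonom[OF this]
  show "dmonom (shift_var v \<mu>) (of_nat (Poly_Mapping.lookup \<mu> v) :: 'a)
          \<in> graded I (int (weight \<mu>) + 1)"
    by (simp add: weight_shift_var[OF v] add.commute)
qed

lemma graded_der:
  assumes "p \<in> graded I w"
  shows "der (p :: 'a :: constant_field dpoly) \<in> graded I (w + 1)"
  unfolding der_dpoly_def
proof (rule graded_sum)
  fix \<mu> assume "\<mu> \<in> monoms p"
  hence \<mu>: "fst ` Poly_Mapping.keys \<mu> \<subseteq> I" "w = int (weight \<mu>)"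
    using assms by (auto simp: graded_iff)
  show "dmonom \<mu> (der (dcoeff p \<mu>)) + dconst (dcoeff p \<mu>) * der_pprod \<mu> \<in> graded I (w + 1)"
    using graded_mult[OF graded_dconst graded_der_pprod[OF \<mu>(1)]] by (simp add: \<mu>(2))
qed

lemma graded_funpow_der:
  assumes "p \<in> graded I w"
  shows "(der ^^ k) (p :: 'a :: constant_field dpoly) \<in> graded I (w + int k)"
proof (induction k)
  case (Suc k)
  from graded_der[OF this] show ?case by (simp add: add_ac)
qed (use assms in simp)

text \<open>A variable of index at least 2 has weight at least 2.\<close>

lemma graded_1_eq_0:
  assumes "p \<in> graded {2..n} 1"
  shows "p = 0"
proof (rule ccontr)
  assume "p \<noteq> 0"
  then obtain \<mu> where "\<mu> \<in> monoms p" using monoms_eq_empty_iff by blast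
  hence \<mu>: "fst ` Poly_Mapping.keys \<mu> \<subseteq> {2..n}" "weight \<mu> = 1"
    using assms by (auto simp: graded_iff)
  hence "Poly_Mapping.keys \<mu> \<noteq> {}" by (auto simp: weight_def simp del: keys_eq_empty)
  then obtain l k where v: "(l, k) \<in> Poly_Mapping.keys \<mu>" by fast
  have "l \<ge> 2" using v \<mu>(1) by force
  with weight_remove_var[OF v] \<mu>(2) show False by linarith
qed

text \<open>
  If \<open>x\<^sub>l\<^sup>(\<^sup>k\<^sup>)\<close> occurs in \<open>\<mu>\<close> and \<open>k\<close> is maximal for the variables \<open>x\<^sub>l\<^sup>(\<^sup>k\<^sup>)\<close> in \<open>p\<close>, then the power product
  obtained from \<open>\<mu>\<close> by differentiating \<open>x\<^sub>l\<^sup>(\<^sup>k\<^sup>)\<close> arises in \<open>der p\<close> in this way only.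
\<close>
lemma der_eq_0_imp_const:
  fixes p :: "'a :: constant_field dpoly"
  assumes "der p = 0" and "\<mu>0 \<in> monoms p"
  shows "\<mu>0 = 0"
proof (rule ccontr)
  assume "\<mu>0 \<noteq> 0"
  then obtain l k0 where lk0: "(l, k0) \<in> Poly_Mapping.keys \<mu>0"
    by (metis keys_eq_empty equals0I surj_pair)
  define K where "K = {k. \<exists>\<mu>\<in>monoms p. (l, k) \<in> Poly_Mapping.keys \<mu>}"
  have "K \<subseteq> snd ` (\<Union>\<mu>\<in>monoms p. Poly_Mapping.keys \<mu>)"
    by (force simp: K_def)
  hence fin: "finite K" by (rule finite_subset) auto
  define k where "k = Max K"
  have "k \<in> K" unfolding k_def using fin lk0 assms(2) by (intro Max_in) (auto simp: K_def)
  then obtain \<mu> where \<mu>: "\<mu> \<in> monoms p" "(l, k) \<in> Poly_Mapping.keys \<mu>" by (auto simp: K_def)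
  have "Suc k \<notin> K" using Max_ge[OF fin, of "Suc k"] by (auto simp: k_def)
  hence no: "Poly_Mapping.lookup \<nu> (l, Suc k) = 0" if "\<nu> \<in> monoms p" for \<nu>
    using that by (auto simp: K_def in_keys_iff)
  have eq: "\<nu> = \<mu> \<and> v = (l, k)"
    if "\<nu> \<in> monoms p" "v \<in> Poly_Mapping.keys \<nu>" "shift_var v \<nu> = shift_var (l, k) \<mu>" for \<nu> v
  proof -
    \<comment> \<open>By maximality of \<open>k\<close> the variable \<open>(l, Suc k)\<close>
      occurs in neither \<open>\<mu>\<close> nor \<open>\<nu>\<close>, so only shifting
      \<open>(l, k)\<close> can have produced it.\<close>
    have "Poly_Mapping.lookup (shift_var v \<nu>) (l, Suc k) = 1"
      unfolding that(3) using no[OF \<mu>(1)]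
      by (auto simp: shift_var_def lookup_add lookup_minus lookup_single)
    hence v: "v = (l, k)"
      using no[OF that(1)]
      by (cases v) (auto simp: shift_var_def lookup_add lookup_minus lookup_single when_def split: if_splits)
    have "\<nu> - Poly_Mapping.single v 1 = \<mu> - Poly_Mapping.single v 1"
      using that(3) by (simp add: v shift_var_def)
    hence "\<nu> = \<mu>" using remove_var_add[OF that(2)] remove_var_add[OF \<mu>(2)] v by metis
    with v show ?thesis by simp
  qed
  have "0 = dcoeff (der p) (shift_var (l, k) \<mu>)"
    by (simp add: assms dcoeff_0)
  also have "\<dots> = (\<Sum>\<nu>\<in>monoms p. \<Sum>v\<in>Poly_Mapping.keys \<nu>.
      if shift_var v \<nu> = shift_var (l, k) \<mu> then dcoeff p \<nu> * of_nat (Poly_Mapping.lookup \<nu> v) else 0)"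
    (is "_ = (\<Sum>\<nu>\<in>_. ?F \<nu>)")
    by (simp add: der_dpoly_def dcoeff_sum der_pprod_def dconst_def sum_distrib_left dmonom_mult
        dcoeff_dmonom')
  also have "\<dots> = (\<Sum>\<nu>\<in>monoms p. if \<nu> = \<mu> then \<Sum>v\<in>Poly_Mapping.keys \<mu>.
      if v = (l, k) then dcoeff p \<mu> * of_nat (Poly_Mapping.lookup \<mu> (l, k)) else 0 else 0)"
  proof (intro sum.cong refl)
    fix \<nu> assume \<nu>: "\<nu> \<in> monoms p"
    have "(shift_var v \<nu> = shift_var (l, k) \<mu>) \<longleftrightarrow> \<nu> = \<mu> \<and> v = (l, k)"
      if "v \<in> Poly_Mapping.keys \<nu>" for v
      using eq[OF \<nu> that] by auto
    hence "?F \<nu> = (\<Sum>v\<in>Poly_Mapping.keys \<nu>. if \<nu> = \<mu> then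
      if v = (l, k) then dcoeff p \<mu> * of_nat (Poly_Mapping.lookup \<mu> (l, k)) else 0 else 0)"
      by (intro sum.cong refl) simp
    also have "\<dots> = (if \<nu> = \<mu> then \<Sum>v\<in>Poly_Mapping.keys \<mu>.
      if v = (l, k) then dcoeff p \<mu> * of_nat (Poly_Mapping.lookup \<mu> (l, k)) else 0 else 0)"
      by (cases "\<nu> = \<mu>") simp_all
    finally show "?F \<nu> = (if \<nu> = \<mu> then \<Sum>v\<in>Poly_Mapping.keys \<mu>.
      if v = (l, k) then dcoeff p \<mu> * of_nat (Poly_Mapping.lookup \<mu> (l, k)) else 0 else 0)" .
  qed
  also have "\<dots> = dcoeff p \<mu> * of_nat (Poly_Mapping.lookup \<mu> (l, k))"
    using \<mu> by (simp add: sum.delta)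
  \<comment> \<open>The exponent is positive, so its product with a nonzero coefficient is nonzero
    in characteristic zero.\<close>
  finally show False
    using \<mu> by (simp add: in_monoms_iff in_keys_iff)
qed

text \<open>By \<open>der_eq_0_imp_const\<close> only the trivial power product can occur, and it
  has weight 0.\<close>

lemma graded_der_eq_0:
  assumes "p \<in> graded I w" "w > 0" "der (p :: 'a :: constant_field dpoly) = 0"
  shows "p = 0"
proof -
  have False if "\<mu> \<in> monoms p" for \<mu>
  proof -
    have "\<mu> = 0" using assms(3) that by (rule der_eq_0_imp_const)
    moreover have "int (weight \<mu>) = w" using assms(1) that by (simp add: graded_iff)
    ultimately show False using assms(2) by (simp add: weight_def)
  qed
  hence "monoms p = {}" by blast
  thus ?thesis by (simp add: monoms_eq_empty_iff)
qed


section \<open>Pseudo-differential operators\<close>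

text \<open>A bound in place of the order itself: the zero operator satisfies every bound, so no
  value for ord(0) is needed.\<close>

definition ord_le :: "'a :: zero pdo \<Rightarrow> int \<Rightarrow> bool" where
  "ord_le A k \<longleftrightarrow> (\<forall>i>k. pcoeff A i = 0)"

lemma ord_leI: "(\<And>i. i > k \<Longrightarrow> pcoeff A i = 0) \<Longrightarrow> ord_le A k"
  by (auto simp: ord_le_def)

lemma ord_leD: "ord_le A k \<Longrightarrow> i > k \<Longrightarrow> pcoeff A i = 0"
  by (auto simp: ord_le_def)

lemma ord_le_mono: "ord_le A k \<Longrightarrow> k \<le> l \<Longrightarrow> ord_le A l"
  by (auto simp: ord_le_def)

lemma ord_le_step: "ord_le A k \<Longrightarrow> pcoeff A k = 0 \<Longrightarrow> l = k - 1 \<Longrightarrow> ord_le A l"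
  unfolding ord_le_def by (metis zle_diff1_eq not_le order_le_less linorder_neqE_linordered_idom)

lemma ord_le_add: "ord_le A k \<Longrightarrow> ord_le B k \<Longrightarrow> ord_le (A + B) k"
  by (auto simp: ord_le_def plus_pdo.rep_eq)

lemma ord_le_diff: "ord_le A k \<Longrightarrow> ord_le B k \<Longrightarrow> ord_le (A - B) k"
  by (auto simp: ord_le_def minus_pdo.rep_eq)

lemma ord_le_mult: "ord_le A k \<Longrightarrow> ord_le B l \<Longrightarrow> ord_le (A * B) (k + l)"
  unfolding ord_le_def times_pdo.rep_eq by (auto intro!: ptimes_bound)

lemma ord_le_pdo_monom: "ord_le (pdo_monom a k) k"
  by (simp add: ord_le_def pdo_monom.rep_eq)

text \<open>The filtration by order is separated, which turns approximation to every order into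
  equality.\<close>

lemma ord_le_all_eqI:
  assumes "\<And>k. ord_le (A - B) (- int k)"
  shows "A = B"
proof (rule pdo_eqI)
  fix i
  have "pcoeff (A - B) i = 0"
    using assms[of "nat (1 - i)"] by (rule ord_leD) simp
  thus "pcoeff A i = pcoeff B i" by (simp add: minus_pdo.rep_eq)
qed

section \<open>Leading coefficients of products and commutators\<close>

lemma pcoeff_mult_lead:
  assumes "ord_le A k" "ord_le B l" "s = k + l"
  shows "pcoeff (A * B) s = pcoeff A k * pcoeff B l"
proof -
  have "pcoeff (A * B) s = (\<Sum>i\<in>{k}. \<Sum>p\<le>0. pcoeff A i * of_int (zbinom i p) *
      (der ^^ p) (pcoeff B (s - i + int p)))"
    unfolding times_pdo.rep_eq
    by (rule ptimes_eq[where N = k and N' = l]) (use assms in \<open>auto simp: ord_leD\<close>)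
  thus ?thesis using assms(3) by simp
qed

text \<open>The derivative term comes from the second term of \<partial>^k b = b \<partial>^k + k
  \<partial>(b) \<partial>^(k-1) + ...\<close>

lemma pcoeff_mult_sublead:
  assumes "ord_le A k" "ord_le B l" "s = k + l - 1"
  shows "pcoeff (A * B) s = pcoeff A (k - 1) * pcoeff B l + pcoeff A k * pcoeff B (l - 1) +
           of_int k * pcoeff A k * der (pcoeff B l)"
proof -
  have "pcoeff (A * B) s = (\<Sum>i\<in>{k - 1, k}. \<Sum>p\<in>{..1}. pcoeff A i * of_int (zbinom i p) *
      (der ^^ p) (pcoeff B (s - i + int p)))"
    unfolding times_pdo.rep_eq
    by (rule ptimes_eq[where N = k and N' = l]) (use assms in \<open>auto simp: ord_leD\<close>)
  \<comment> \<open>The index pair \<open>i = k - 1\<close>, \<open>p = 1\<close> of the double sum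
    reaches beyond the order of \<open>B\<close>.\<close>
  also have "pcoeff B (l + 1) = 0"
    using assms(2) by (rule ord_leD) simp
  ultimately show ?thesis unfolding assms(3)
    by (simp add: numeral_eq_Suc atMost_Suc algebra_simps)
qed

text \<open>The terms without derivatives cancel because the coefficient ring is
  commutative.\<close>

lemma pcoeff_commutator:
  assumes "ord_le A k" "ord_le B l" "s = k + l - 1"
  shows "pcoeff (commutator A B) s =
           of_int k * pcoeff A k * der (pcoeff B l) - of_int l * pcoeff B l * der (pcoeff A k)"
  unfolding assms(3)
  using pcoeff_mult_sublead[OF assms(1,2) refl] pcoeff_mult_sublead[OF assms(2,1), of "k + l - 1"]
  by (simp add: commutator_def minus_pdo.rep_eq algebra_simps)

lemma ord_le_commutator:
  assumes "ord_le A k" "ord_le B l" "s = k + l - 1"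
  shows "ord_le (commutator A B) s"
proof (rule ord_le_step)
  show "ord_le (commutator A B) (k + l)"
    using ord_le_mult[OF assms(1,2)] ord_le_mult[OF assms(2,1)]
    by (auto simp: commutator_def add.commute intro: ord_le_diff)
  show "pcoeff (commutator A B) (k + l) = 0"
    using pcoeff_mult_lead[OF assms(1,2) refl] pcoeff_mult_lead[OF assms(2,1) refl]
    by (simp add: commutator_def minus_pdo.rep_eq add.commute mult.commute)
qed (fact assms(3))

lemma commutator_diff_right: "commutator A (B - C) = commutator A B - commutator A C"
  by (simp add: commutator_def algebra_simps)

section \<open>Powers of monic operators of order one\<close>

lemma ord_le_power:
  assumes "ord_le A 1"
  shows "ord_le (A ^ k) (int k)"
proof (induction k)
  case (Suc k)
  from ord_le_mult[OF assms Suc] show ?case by simp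
qed (simp add: ord_le_def one_pdo.rep_eq)

lemma pcoeff_power_lead:
  assumes "ord_le A 1" "pcoeff A 1 = 1"
  shows "pcoeff (A ^ k) (int k) = 1"
proof (induction k)
  case (Suc k)
  thus ?case
    using pcoeff_mult_lead[OF assms(1) ord_le_power[OF assms(1), of k], of "int (Suc k)"] assms(2)
    by simp
qed (simp add: one_pdo.rep_eq)

text \<open>The linearisation of the \<open>k\<close>-th power that drives both existence and uniqueness of roots.\<close>

lemma power_diff_lead:
  assumes A: "ord_le A 1" "pcoeff A 1 = 1" and B: "ord_le B 1" "pcoeff B 1 = 1"
    and AB: "ord_le (A - B) e"
  shows "ord_le (A ^ k - B ^ k) (e + int k - 1) \<and>
    pcoeff (A ^ k - B ^ k) (e + int k - 1) = of_nat k * pcoeff (A - B) e"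
proof (induction k)
  case (Suc k)
  \<comment> \<open>Telescoping without commutativity. As \<open>A ^ k\<close> and \<open>B\<close>
    are monic, the two summands contribute 1 and \<open>k\<close> times the leading coefficient of
    \<open>A - B\<close>.\<close>
  have eq: "A ^ Suc k - B ^ Suc k = A ^ k * (A - B) + (A ^ k - B ^ k) * B"
    by (simp add: power_Suc2 algebra_simps del: power_Suc)
  have s: "e + int (Suc k) - 1 = int k + e" "e + int (Suc k) - 1 = e + int k - 1 + 1" by auto
  note P = ord_le_power[OF A(1), of k] and IH = conjunct1[OF Suc]
  have "ord_le (A ^ Suc k - B ^ Suc k) (e + int (Suc k) - 1)"
    unfolding eq using ord_le_mult[OF P AB] ord_le_mult[OF IH B(1)]
    by (intro ord_le_add) (simp_all add: add_ac)
  moreover have "pcoeff (A ^ Suc k - B ^ Suc k) (e + int (Suc k) - 1) =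
      of_nat (Suc k) * pcoeff (A - B) e"
    unfolding eq plus_pdo.rep_eq
    using pcoeff_mult_lead[OF P AB s(1)] pcoeff_mult_lead[OF IH B(1) s(2)]
      pcoeff_power_lead[OF A] Suc B(2)
    by (simp add: algebra_simps)
  ultimately show ?case by blast
qed (simp add: ord_le_def zero_pdo.rep_eq)

subsection \<open>Normal form\<close>

lemma pdo_monom_mult_D: "pdo_monom a k * pdo_monom 1 l = (pdo_monom a (k + l) :: 'a :: differential_ring pdo)"
proof (rule pdo_eqI)
  fix s
  have "pcoeff (pdo_monom a k * pdo_monom 1 l :: 'a pdo) s =
      (\<Sum>p\<le>nat (k + l - s). a * of_int (zbinom k p) * (der ^^ p) (if s - k + int p = l then 1 else 0))"
    unfolding times_pdo.rep_eq pdo_monom.rep_eq by (subst ptimes_monom_left[where N = l]) auto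
  also have "\<dots> = (\<Sum>p\<le>nat (k + l - s). if p = 0 then if s = k + l then a else 0 else 0)"
    by (intro sum.cong refl) (auto simp: funpow_der_1)
  finally show "pcoeff (pdo_monom a k * pdo_monom 1 l :: 'a pdo) s = pcoeff (pdo_monom a (k + l)) s"
    by (simp add: pdo_monom.rep_eq sum.delta)
qed

lemma pdo_D_power: "pdo_D ^ k = (pdo_monom 1 (int k) :: 'a :: differential_ring pdo)"
proof (induction k)
  case 0
  show ?case by (rule pdo_eqI) (simp add: one_pdo.rep_eq pdo_monom.rep_eq)
qed (simp add: pdo_monom_mult_D)

lemma pcoeff_sum: "pcoeff (\<Sum>x\<in>A. f x) i = (\<Sum>x\<in>A. pcoeff (f x :: 'a :: differential_ring pdo) i)"
  by (induction A rule: infinite_finite_induct) (auto simp: zero_pdo.rep_eq plus_pdo.rep_eq)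

lemma pcoeff_normal_op:
  "pcoeff (normal_op n a) i =
     (if i = int n then 1 else if 0 \<le> i \<and> i \<le> int n - 2 then a (nat (int n - i)) else 0)"
proof -
  have "pcoeff (normal_op n a) i = (if i = int n then 1 else 0) +
      (\<Sum>l=2..n. if i = int (n - l) then a l else 0)"
    by (simp add: normal_op_def plus_pdo.rep_eq pcoeff_sum pdo_D_power pdo_monom_mult_D pdo_monom.rep_eq)
  also have "(\<Sum>l=2..n. if i = int (n - l) then a l else 0) =
      (\<Sum>l=2..n. if l = nat (int n - i) then if 0 \<le> i then a l else 0 else 0)"
    by (intro sum.cong refl) auto
  also have "\<dots> = (if 0 \<le> i \<and> i \<le> int n - 2 then a (nat (int n - i)) else 0)"
    by (auto simp: sum.delta)
  finally show ?thesis by auto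
qed

lemma ord_le_normal_op: "ord_le (normal_op n a) (int n)"
  by (auto simp: ord_le_def pcoeff_normal_op)

lemma (in diff_ring_hom) map_pdo_normal_op: "map_pdo f (normal_op n a) = normal_op n (\<lambda>l. f (a l))"
  by (rule pdo_eqI) (simp add: pcoeff_map_pdo pcoeff_normal_op hom_0 hom_1)

section \<open>Evaluation of the coefficient equations\<close>

lemma diff_ring_hom_dconst: "diff_ring_hom dconst"
  by unfold_locales (simp_all add: dconst_def dmonom_add dmonom_mult dmonom_0_1 der_dmonom)

lemma map_deval_formal_P: "map_pdo (deval q) (formal_P m) = normal_op m q"
  unfolding formal_P_def diff_ring_hom.map_pdo_normal_op[OF diff_ring_hom_deval]
  by (simp add: deval_dvar)

text \<open>Evaluation returns the embedded \<open>formal_L n\<close> to itself and sends the formal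
  operator to \<open>normal_op m q\<close>, so the system becomes a condition on one commutator over
  C{U}.\<close>

lemma deval_E_coeff:
  "deval q (E_coeff n m k) = pcoeff (commutator (formal_L n) (normal_op m q)) k"
proof -
  interpret deval: diff_ring_hom "deval q" by (rule diff_ring_hom_deval)
  interpret dconst: diff_ring_hom "dconst :: 'a dpoly \<Rightarrow> 'a dpoly dpoly" by (rule diff_ring_hom_dconst)
  have "map_pdo (deval q) (map_pdo dconst (formal_L n)) = formal_L n"
    by (rule pdo_eqI) (simp add: deval.pcoeff_map_pdo dconst.pcoeff_map_pdo deval_dconst)
  thus ?thesis
    by (simp add: E_coeff_def deval.map_pdo_commutator map_deval_formal_P flip: deval.pcoeff_map_pdo)
qed

subsection \<open>Homogeneous operators\<close>

definition homogeneous_op :: "nat set \<Rightarrow> int \<Rightarrow> 'a :: comm_ring_1 dpoly pdo \<Rightarrow> bool" where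
  "homogeneous_op I r A \<longleftrightarrow> (\<forall>i. pcoeff A i \<in> graded I (r - i))"

lemma homogeneous_opD: "homogeneous_op I r A \<Longrightarrow> pcoeff A i \<in> graded I (r - i)"
  by (simp add: homogeneous_op_def)

lemma homogeneous_op_add:
  "homogeneous_op I r A \<Longrightarrow> homogeneous_op I r B \<Longrightarrow>
     homogeneous_op I r (A + B :: 'a :: differential_ring dpoly pdo)"
  by (auto simp: homogeneous_op_def plus_pdo.rep_eq intro: graded_add)

lemma homogeneous_op_diff:
  "homogeneous_op I r A \<Longrightarrow> homogeneous_op I r B \<Longrightarrow>
     homogeneous_op I r (A - B :: 'a :: differential_ring dpoly pdo)"
  by (auto simp: homogeneous_op_def minus_pdo.rep_eq intro: graded_diff)

text \<open>In the product formula the p-th derivative raises the weight by p, and the coefficient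
  it acts on has its index raised by p, hence its weight lowered by p.\<close>

lemma homogeneous_op_mult:
  fixes A B :: "'a :: constant_field dpoly pdo"
  assumes "homogeneous_op I r A" "homogeneous_op I r' B"
  shows "homogeneous_op I (r + r') (A * B)"
  unfolding homogeneous_op_def
proof
  fix s
  obtain N where A: "\<And>i. i > N \<Longrightarrow> pcoeff A i = 0" using pcoeff[of A] by blast
  obtain N' where B: "\<And>i. i > N' \<Longrightarrow> pcoeff B i = 0" using pcoeff[of B] by blast
  have "pcoeff A i * of_int (zbinom i p) * (der ^^ p) (pcoeff B (s - i + int p)) \<in> graded I (r + r' - s)"
    for i p
  proof -
    have "pcoeff A i * of_int (zbinom i p) * (der ^^ p) (pcoeff B (s - i + int p))
            \<in> graded I ((r - i) + 0 + (r' - (s - i + int p) + int p))"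
      using assms unfolding homogeneous_op_def
      by (intro graded_mult graded_of_int graded_funpow_der) auto
    thus ?thesis by (simp add: algebra_simps)
  qed
  moreover have "pcoeff (A * B) s = (\<Sum>i\<in>{s - N'..N}. \<Sum>p\<le>nat (N + N' - s). pcoeff A i *
      of_int (zbinom i p) * (der ^^ p) (pcoeff B (s - i + int p)))"
    unfolding times_pdo.rep_eq by (rule ptimes_eq[OF A B]) auto
  ultimately show "pcoeff (A * B) s \<in> graded I (r + r' - s)"
    by (auto intro!: graded_sum)
qed

lemma homogeneous_op_power:
  fixes A :: "'a :: constant_field dpoly pdo"
  assumes "homogeneous_op I 1 A"
  shows "homogeneous_op I (int k) (A ^ k)"
proof (induction k)
  case 0
  show ?case by (simp add: homogeneous_op_def one_pdo.rep_eq graded_1)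
next
  case (Suc k)
  from homogeneous_op_mult[OF assms Suc] show ?case by simp
qed

lemma homogeneous_op_pdo_monom:
  "a \<in> graded I (r - k) \<Longrightarrow> homogeneous_op I r (pdo_monom (a :: 'a :: comm_ring_1 dpoly) k)"
  by (auto simp: homogeneous_op_def pdo_monom.rep_eq)

lemma homogeneous_op_positive_part:
  "homogeneous_op I r A \<Longrightarrow> homogeneous_op I r (positive_part (A :: 'a :: comm_ring_1 dpoly pdo))"
  by (auto simp: homogeneous_op_def positive_part.rep_eq)

lemma homogeneous_op_normal_op:
  fixes a :: "nat \<Rightarrow> 'a :: differential_ring dpoly"
  assumes "\<And>l. l \<in> {2..n} \<Longrightarrow> a l \<in> graded I (int l)"
  shows "homogeneous_op I (int n) (normal_op n a)"
  unfolding homogeneous_op_def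
proof
  fix i
  show "pcoeff (normal_op n a) i \<in> graded I (int n - i)"
  proof (cases "0 \<le> i \<and> i \<le> int n - 2")
    case True
    hence "nat (int n - i) \<in> {2..n}" by auto
    from assms[OF this] True show ?thesis by (simp add: pcoeff_normal_op)
  qed (auto simp: pcoeff_normal_op graded_1)
qed

lemma homogeneous_op_formal_L:
  "homogeneous_op {2..n} (int n) (formal_L n :: 'c :: constant_field dpoly pdo)"
  unfolding formal_L_def using graded_dvar[where k = 0 and 'a = 'c]
  by (intro homogeneous_op_normal_op) force

subsection \<open>The monic root\<close>

text \<open>Characteristic zero makes \<open>n\<close> invertible among the constants; the root
  construction divides by it at every step.\<close>

lemma dconst_inverse_of_nat:
  fixes p :: "'c :: constant_field dpoly"
  assumes "n > 0"
  shows "of_nat n * (dconst (1 / of_nat n) * p) = p"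
proof -
  have "of_nat n = (dconst (of_nat n) :: 'c dpoly)"
    by (simp add: diff_ring_hom.hom_of_nat[OF diff_ring_hom_dconst])
  hence "of_nat n * dconst (1 / of_nat n) = (1 :: 'c dpoly)"
    using assms by (simp add: dconst_def dmonom_mult dmonom_0_1)
  thus ?thesis by (simp flip: mult.assoc)
qed

lemma of_nat_mult_dpoly_eq_0:
  fixes p :: "'c :: constant_field dpoly"
  assumes "n > 0" "of_nat n * p = 0"
  shows "p = 0"
  using dconst_inverse_of_nat[OF assms(1), of p] assms(2)
  by (simp only: mult.left_commute[of "of_nat n"] mult_zero_right)

context
  fixes n :: nat and I :: "nat set" and L :: "'c :: constant_field dpoly pdo"
  assumes n: "n > 0" and L: "homogeneous_op I (int n) L" "ord_le L (int n)" "pcoeff L (int n) = 1"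
begin

text \<open>By \<open>power_diff_lead\<close>, adding c \<partial>^(-k) changes the coefficient of
  the n-th power at order n - 1 - k by n c, so c is the remaining defect there divided by n.\<close>

primrec root_approx :: "nat \<Rightarrow> 'c dpoly pdo" where
  "root_approx 0 = pdo_D"
| "root_approx (Suc k) = root_approx k +
     pdo_monom (dconst (1 / of_nat n) * pcoeff (L - root_approx k ^ n) (int n - 1 - int k)) (- int k)"

lemma ord_le_root_approx: "ord_le (root_approx k) 1"
  by (induction k) (auto intro!: ord_le_add intro: ord_le_mono[OF ord_le_pdo_monom])

lemma pcoeff_root_approx_1: "pcoeff (root_approx k) 1 = 1"
  by (induction k) (auto simp: plus_pdo.rep_eq pdo_monom.rep_eq)

text \<open>The defect at order n - 1 - k has weight k + 1, as required at \<partial>^(-k) in an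
  operator of weight 1; the constant 1/n has weight 0.\<close>

lemma homogeneous_op_root_approx: "homogeneous_op I 1 (root_approx k)"
proof (induction k)
  case 0
  show ?case by (simp add: homogeneous_op_pdo_monom graded_1)
next
  case (Suc k)
  have "homogeneous_op I (int n) (L - root_approx k ^ n)"
    by (intro homogeneous_op_diff L homogeneous_op_power Suc)
  hence "pcoeff (L - root_approx k ^ n) (int n - 1 - int k) \<in> graded I (int n - (int n - 1 - int k))"
    by (rule homogeneous_opD)
  from graded_mult[OF graded_dconst this]
  have "dconst (1 / of_nat n) * pcoeff (L - root_approx k ^ n) (int n - 1 - int k)
          \<in> graded I (1 - (- int k))"
    by simp
  thus ?case
    unfolding root_approx.simps by (intro homogeneous_op_add Suc homogeneous_op_pdo_monom)
qed

lemma ord_le_root_approx_power: "ord_le (L - root_approx k ^ n) (int n - 1 - int k)"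
proof (induction k)
  case 0
  show ?case
  proof (rule ord_le_step)
    \<comment> \<open>Both operators are monic of order \<open>n\<close>, so the difference loses
      its top term.\<close>
    show "ord_le (L - root_approx 0 ^ n) (int n)"
      by (intro ord_le_diff L ord_le_power ord_le_root_approx)
    show "pcoeff (L - root_approx 0 ^ n) (int n) = 0"
      by (simp only: minus_pdo.rep_eq L pcoeff_power_lead[OF ord_le_root_approx pcoeff_root_approx_1])
        simp
  qed simp
next
  case (Suc k)
  let ?A = "root_approx (Suc k)" and ?B = "root_approx k"
  let ?t = "int n - 1 - int k"
  have AB: "?A - ?B = pdo_monom (dconst (1 / of_nat n) * pcoeff (L - ?B ^ n) ?t) (- int k)" by simp
  have "ord_le (?A - ?B) (- int k)"
    unfolding AB by (rule ord_le_pdo_monom)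
  note D = power_diff_lead[OF ord_le_root_approx pcoeff_root_approx_1 ord_le_root_approx
      pcoeff_root_approx_1 this, of n]
  have t: "- int k + int n - 1 = ?t" by simp
  have eq: "L - ?A ^ n = (L - ?B ^ n) - (?A ^ n - ?B ^ n)"
    by (simp del: root_approx.simps)
  show ?case
  proof (rule ord_le_step)
    show "ord_le (L - ?A ^ n) ?t"
      unfolding eq using D Suc unfolding t by (blast intro: ord_le_diff)
    have "pcoeff (?A ^ n - ?B ^ n) ?t = pcoeff (L - ?B ^ n) ?t"
      using D unfolding t AB pdo_monom.rep_eq by (simp add: dconst_inverse_of_nat[OF n] del: root_approx.simps)
    thus "pcoeff (L - ?A ^ n) ?t = 0"
      unfolding eq minus_pdo.rep_eq[of "L - _"] by simp
  qed simp
qed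

text \<open>The step from \<open>k\<close> to \<open>Suc k\<close> alters only the coefficient at
  \<open>- k\<close>, so the one at \<open>i\<close> is final from stage 1 - i on.\<close>

lemma root_approx_stable:
  assumes "1 - i \<le> int k"
  shows "pcoeff (root_approx k) i = pcoeff (root_approx (nat (1 - i))) i"
proof -
  from assms have "nat (1 - i) \<le> k" by simp
  thus ?thesis
    by (induction k rule: dec_induct) (auto simp: plus_pdo.rep_eq pdo_monom.rep_eq)
qed

lemma ex_root: "\<exists>Q. homogeneous_op I 1 Q \<and> ord_le Q 1 \<and> pcoeff Q 1 = 1 \<and> Q ^ n = L"
proof -
  \<comment> \<open>The limit of the approximations: each coefficient is read off at the stage where
    it becomes final.\<close>
  define Q where "Q = Abs_pdo (\<lambda>i. pcoeff (root_approx (nat (1 - i))) i)"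
  have Q: "pcoeff Q i = pcoeff (root_approx (nat (1 - i))) i" for i
    unfolding Q_def
    by (subst Abs_pdo_inverse) (auto intro!: exI[of _ 1] ord_leD[OF ord_le_root_approx])
  have hom: "homogeneous_op I 1 Q"
    using homogeneous_op_root_approx by (simp add: homogeneous_op_def Q)
  have ord: "ord_le Q 1"
    by (rule ord_leI) (simp only: Q ord_leD[OF ord_le_root_approx])
  have lead: "pcoeff Q 1 = 1"
    by (simp add: Q pdo_monom.rep_eq)
  have "ord_le (L - Q ^ n) (- int k)" for k
  proof -
    \<comment> \<open>Stage \<open>j\<close> leaves errors of order at most n - 1 - j = -1 - k,
      below the required bound.\<close>
    define j where "j = k + n"
    have "ord_le (Q - root_approx j) (- int j)"
      using root_approx_stable[of _ j] by (auto simp: ord_le_def minus_pdo.rep_eq Q)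
    from power_diff_lead[OF ord lead ord_le_root_approx pcoeff_root_approx_1 this, of n]
    have "ord_le (Q ^ n - root_approx j ^ n) (int n - 1 - int j)"
      by (simp add: algebra_simps)
    with ord_le_root_approx_power[of j]
    have "ord_le ((L - root_approx j ^ n) - (Q ^ n - root_approx j ^ n)) (int n - 1 - int j)"
      by (rule ord_le_diff)
    thus ?thesis by (auto simp: j_def elim: ord_le_mono)
  qed
  hence "L = Q ^ n" by (rule ord_le_all_eqI)
  with hom ord lead show ?thesis by blast
qed

text \<open>Equal n-th powers force n times the top coefficient of \<open>A - B\<close> to vanish,
  so the order of the difference drops forever. Monicity starts the descent and excludes multiples
  by roots of unity.\<close>

lemma root_unique:
  assumes A: "ord_le A 1" "pcoeff A 1 = 1" "A ^ n = L" and B: "ord_le B 1" "pcoeff B 1 = 1" "B ^ n = L"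
  shows "A = B"
proof (rule ord_le_all_eqI)
  fix k
  show "ord_le (A - B) (- int k)"
  proof (induction k)
    case 0
    show ?case
    proof (rule ord_le_step)
      show "ord_le (A - B) 1" using A(1) B(1) by (rule ord_le_diff)
    qed (auto simp: minus_pdo.rep_eq A B)
  next
    case (Suc k)
    show ?case
    proof (rule ord_le_step[OF Suc])
      have "of_nat n * pcoeff (A - B) (- int k) = 0"
        using power_diff_lead[OF A(1,2) B(1,2) Suc, of n] A(3) B(3) by (simp add: zero_pdo.rep_eq)
      with n show "pcoeff (A - B) (- int k) = 0" by (rule of_nat_mult_dpoly_eq_0)
    qed simp
  qed
qed

text \<open>Resolves the definite description: the constructed root has coefficients in the
  prescribed ring, and uniqueness holds even among operators over all differential
  polynomials.\<close>

lemma monic_root: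
  assumes "I \<subseteq> J"
  defines "Q \<equiv> monic_root (dpolys_in J) n L"
  shows "homogeneous_op I 1 Q" "ord_le Q 1" "pcoeff Q 1 = 1" "Q ^ n = L"
proof -
  obtain R where R: "homogeneous_op I 1 R" "ord_le R 1" "pcoeff R 1 = 1" "R ^ n = L"
    using ex_root by blast
  have "Q = R"
    unfolding Q_def monic_root_def
  proof (rule the_equality)
    have "range (pcoeff R) \<subseteq> dpolys_in J"
      using R(1) assms(1) by (fastforce simp: homogeneous_op_def graded_def dpolys_in_def)
    thus "range (pcoeff R) \<subseteq> dpolys_in J \<and> pcoeff R 1 = 1 \<and> (\<forall>i>1. pcoeff R i = 0) \<and> R ^ n = L"
      using R by (auto simp: ord_le_def)
  qed (use root_unique R in \<open>auto simp: ord_le_def\<close>)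
  with R show "homogeneous_op I 1 Q" "ord_le Q 1" "pcoeff Q 1 = 1" "Q ^ n = L" by simp_all
qed

end

section \<open>Operators almost commuting with \<open>L\<close>\<close>

theorem theorem4p2:
  fixes n m :: nat
    and q :: "nat \<Rightarrow> 'c :: constant_field dpoly"
  assumes "n \<ge> 2" and "m \<ge> 2"
    and "\<And>l. l \<in> {2..m} \<Longrightarrow> q l \<in> dpolys_U n"
    and "\<And>l. l \<in> {2..m} \<Longrightarrow> homogeneous l (q l)"
  shows "map_pdo (deval q) (formal_P m) = P_op n m \<longleftrightarrow>
    (\<forall>j\<in>{3..m + 1}. deval q (E_coeff n m (int n + int m - int j)) = 0)"
proof -
  define L where "L = (formal_L n :: 'c dpoly pdo)"
  define Q where "Q = monic_root (dpolys_U n) n L"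
  define A where "A = normal_op m q"
  define P where "P = (P_op n m :: 'c dpoly pdo)"
  have n0: "n > 0" using assms(1) by simp
  have L: "homogeneous_op {2..n} (int n) L" "ord_le L (int n)" "pcoeff L (int n) = 1"
    unfolding L_def using homogeneous_op_formal_L
    by (auto simp: formal_L_def ord_le_normal_op pcoeff_normal_op)
  have Q: "homogeneous_op {2..n} 1 Q" "ord_le Q 1" "pcoeff Q 1 = 1" "Q ^ n = L"
    unfolding Q_def using monic_root[OF n0 L order_refl] by simp_all
  have P: "P = positive_part (Q ^ m)"
    by (simp add: P_def P_op_def Q_def L_def)
  have neg: "ord_le (Q ^ m - P) (-1)"
    by (simp add: P ord_le_def minus_pdo.rep_eq positive_part.rep_eq)
  have "commutator L (Q ^ m) = 0"
    by (simp add: commutator_def power_add[symmetric] add.commute flip: Q(4) power_mult)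
  hence "commutator L P = 0 - commutator L (Q ^ m - P)"
    by (simp add: commutator_diff_right)
  \<comment> \<open>The bound is n + (-1) - 1.\<close>
  moreover have "ord_le (commutator L (Q ^ m - P)) (int n - 2)"
    by (rule ord_le_commutator[OF L(2) neg]) simp
  ultimately have ord_LP: "ord_le (commutator L P) (int n - 2)"
    by (simp only: ord_le_def minus_pdo.rep_eq zero_pdo.rep_eq) simp
  have "A = P" if E: "\<forall>j\<in>{3..m + 1}. pcoeff (commutator L A) (int n + int m - int j) = 0"
  proof -
    define D where "D = A - P"
    have q: "q l \<in> graded {2..n} (int l)" if "l \<in> {2..m}" for l
      using assms(3,4)[OF that] by (auto simp: graded_def homogeneous_def)
    have homD: "homogeneous_op {2..n} (int m) D"
      unfolding D_def A_def P
      by (intro homogeneous_op_diff homogeneous_op_normal_op homogeneous_op_positive_part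
          homogeneous_op_power Q q)
    have "ord_le D (int m)"
      unfolding D_def using ord_le_power[OF Q(2), of m]
      by (intro ord_le_diff)
        (simp_all add: A_def P ord_le_normal_op, simp add: ord_le_def positive_part.rep_eq)
    moreover have "pcoeff D (int m) = 0"
      using pcoeff_power_lead[OF Q(2,3), of m]
      by (simp add: D_def minus_pdo.rep_eq A_def P positive_part.rep_eq pcoeff_normal_op)
    ultimately have "ord_le D (int m - 1)" by (rule ord_le_step) simp
    \<comment> \<open>The equations start at \<open>j = 3\<close> and do not reach this coefficient;
      it vanishes because no nonzero element of C{U} has weight 1.\<close>
    moreover have "pcoeff D (int m - 1) = 0"
    proof (rule graded_1_eq_0)
      show "pcoeff D (int m - 1) \<in> graded {2..n} 1"
        using homogeneous_opD[OF homD, of "int m - 1"] by simp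
    qed
    ultimately have start: "ord_le D (int m - 2)" by (rule ord_le_step) simp
    \<comment> \<open>One equation removes one order; after m - 1 of them the bound is -1.\<close>
    have "ord_le D (int m - 2 - int i)" if "i \<le> m - 1" for i
      using that
    proof (induction i)
      case (Suc i)
      define t where "t = int m - 2 - int i"
      have t: "0 \<le> t" "t \<le> int m - 2" using Suc.prems by (auto simp: t_def)
      have ordD: "ord_le D t" using Suc by (simp add: t_def)
      have "pcoeff (commutator L A) (int n + t - 1) = 0"
        \<comment> \<open>With t = m - 2 - i, the index n + t - 1 is n + m - j for j = i +
          3.\<close>
        using E[rule_format, of "i + 3"] Suc.prems by (simp add: t_def algebra_simps)
      moreover have "pcoeff (commutator L P) (int n + t - 1) = 0"
        using ord_LP by (rule ord_leD) (use t in simp)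
      ultimately have "pcoeff (commutator L D) (int n + t - 1) = 0"
        by (simp add: D_def commutator_diff_right minus_pdo.rep_eq)
      \<comment> \<open>The other term of the commutator formula contains the derivative of the
        leading coefficient 1 of \<open>L\<close>.\<close>
      hence "of_nat n * der (pcoeff D t) = 0"
        unfolding pcoeff_commutator[OF L(2) ordD refl] L(3) der_1 of_int_of_nat_eq by simp
      with n0 have "der (pcoeff D t) = 0" by (rule of_nat_mult_dpoly_eq_0)
      moreover have "int m - t > 0" using t by linarith
      ultimately have "pcoeff D t = 0"
        using graded_der_eq_0[OF homogeneous_opD[OF homD]] by blast
      with ordD show ?case by (rule ord_le_step) (simp add: t_def)
    qed (use start in simp)
    from this[of "m - 1"] have ord: "ord_le D (-1)" using assms(2) by (simp add: of_nat_diff)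
    have "pcoeff D i = 0" for i
    proof (cases "i < 0")
      case True
      thus ?thesis by (simp add: D_def A_def P minus_pdo.rep_eq positive_part.rep_eq pcoeff_normal_op)
    qed (use ord in \<open>auto simp: ord_le_def\<close>)
    thus "A = P" unfolding D_def by (intro pdo_eqI) (simp add: minus_pdo.rep_eq)
  qed
  \<comment> \<open>The converse direction: j at most m + 1 keeps the index at least n - 1, above
    the order of the commutator.\<close>
  moreover have "pcoeff (commutator L P) (int n + int m - int j) = 0" if "j \<in> {3..m + 1}" for j
    using ord_LP by (rule ord_leD) (use that in auto)
  ultimately show ?thesis
    unfolding map_deval_formal_P deval_E_coeff L_def[symmetric] A_def[symmetric] P_def[symmetric]
    by blast
qed

end
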